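(* Let $F$ be a finite extension of $\mathbb{Q}_p$ with ring of integers $\mathcal{O}_F$. Let $G$ be a split, connected, simply-connected semisimple group, $B$ a Borel subgroup of $G$, and $T$ a maximal torus in $B$, all defined over $\mathcal{O}_F$. Let $P=MN$ be a parabolic subgroup of $G$ containing $B$, where $M$ is the unique Levi subgroup of $P$ containing $T$, and assume that $P$ is of semisimple rank $1$. Let $\mu\in X=X_*(T)$ be $G$-dominant. Then $$\varphi_M(P_\mu)=\left\{\nu_1\in X_M : \text{(i) } \nu_1 \text{ and } \mu \text{ have the same image in } X_G;\ \text{(ii) the image of } \nu_1 \text{ in } \mathfrak{a}_M \text{ lies in } \mathrm{pr}_M(\operatorname{Conv}(W\mu))\right\}.$$
   Context: Notation: $X=X_*(T)$ is the group of cocharacters of $T$. $X_G$ and $X_M$ are the quotients of $X$ by the coroot lattice for $G$ and for $M$, respectively, and $\varphi_G:X\to X_G$, $\varphi_M:X\to X_M$ are the natural projections; since the coroot lattice of $M$ is contained in that of $G$, there is a natural map $X_M\to X_G$, and the "image of $\nu_1$ in $X_G$" refers to it (the image of $\mu$ in $X_G$ is $\varphi_G(\mu)$). $W$ is the Weyl group of $T$ in $G$, acting on $X$; $W\mu=\{w(\mu):w\in W\}$; $\mathfrak{a}=X\otimes_{\mathbb{Z}}\mathbb{R}$; $\operatorname{Conv}(W\mu)$ is the convex hull of $W\mu$ in $\mathfrak{a}$. Define $$P_\mu=\{\nu\in X : \varphi_G(\nu)=\varphi_G(\mu)\ \text{and}\ \nu\in\operatorname{Conv}(W\mu)\}.$$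 Let $\mathfrak{a}_M=X_M\otimes_{\mathbb{Z}}\mathbb{R}$ and let $\mathrm{pr}_M:\mathfrak{a}\to\mathfrak{a}_M$ be the natural projection induced by $\varphi_M$. The image of $\nu_1\in X_M$ in $\mathfrak{a}_M$ is $\nu_1\otimes 1$. Dominance is with respect to $B$. "$P$ is of semisimple rank $1$" means that its Levi subgroup $M$ has semisimple rank $1$ (i.e. the root system of $M$ is $\{\pm\alpha\}$ for a single root $\alpha$). *)

theory Defs
  imports "HOL-Analysis.Analysis" "HOL-Library.Poly_Mapping"
begin

section \<open>Abelian groups as modules over the integers\<close>

definition zmult :: "int \<Rightarrow> 'a::ab_group_add \<Rightarrow> 'a" where
  "zmult n x = ((\<lambda>y. x + y) ^^ nat n) 0 - ((\<lambda>y. x + y) ^^ nat (- n)) 0"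

lemma zmult_0 [simp]: "zmult 0 x = 0"
  by (simp add: zmult_def)

lemma zmult_1 [simp]: "zmult 1 x = x"
  by (simp add: zmult_def)

lemma zmult_Suc: "zmult (n + 1) x = zmult n x + x"
proof (cases "n \<ge> 0")
  case True
  then have "nat (n + 1) = Suc (nat n)" by simp
  with True show ?thesis by (simp add: zmult_def add.commute)
next
  case False
  then have "nat (- n) = Suc (nat (- (n + 1)))" by simp
  with False show ?thesis by (simp add: zmult_def)
qed

lemma zmult_add_left: "zmult (m + n) x = zmult m x + zmult n x"
proof (induction n rule: int_induct[where k = 0])
  case base
  show ?case by simp
next
  case (step1 i)
  then show ?case using zmult_Suc[of "m + i" x] zmult_Suc[of i x] by (simp add: add.assoc)
next
  case (step2 i)
  then show ?case using zmult_Suc[of "m + (i - 1)" x] zmult_Suc[of "i - 1" x]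
    by (simp add: algebra_simps)
qed

lemma zmult_add_right: "zmult n (x + y) = zmult n x + zmult n y"
proof (induction n rule: int_induct[where k = 0])
  case base
  show ?case by simp
next
  case (step1 i)
  then show ?case
    using zmult_Suc[of i x] zmult_Suc[of i y] zmult_Suc[of i "x + y"] by (simp add: algebra_simps)
next
  case (step2 i)
  then show ?case
    using zmult_Suc[of "i - 1" x] zmult_Suc[of "i - 1" y] zmult_Suc[of "i - 1" "x + y"]
    by (simp add: algebra_simps)
qed

lemma zmult_assoc: "zmult m (zmult n x) = zmult (m * n) x"
proof (induction m rule: int_induct[where k = 0])
  case base
  show ?case by simp
next
  case (step1 i)
  then show ?case
    using zmult_Suc[of i "zmult n x"] zmult_add_left[of "i * n" n x] by (simp add: algebra_simps)
next
  case (step2 i)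
  then show ?case
    using zmult_Suc[of "i - 1" "zmult n x"] zmult_add_left[of "(i - 1) * n" n x]
    by (simp add: algebra_simps)
qed

interpretation zmod: module "zmult :: int \<Rightarrow> 'a \<Rightarrow> 'a::ab_group_add"
  by unfold_locales (simp_all add: zmult_add_left zmult_add_right zmult_assoc)

definition finite_free :: "'a::ab_group_add itself \<Rightarrow> bool" where
  "finite_free _ \<longleftrightarrow> (\<exists>b :: 'a set. finite b \<and> \<not> zmod.dependent b \<and> zmod.span b = UNIV)"

text \<open>A quotient group is given by its projection: \<open>\<phi>\<close> exhibits its target as the quotient
  of its source by the subgroup \<open>H\<close>.\<close>

definition quotient_projection :: "('a::ab_group_add \<Rightarrow> 'b::ab_group_add) \<Rightarrow> 'a set \<Rightarrow> bool" where
  "quotient_projection \<phi> H \<longleftrightarrow> Modules.additive \<phi> \<and> surj \<phi> \<and> {x. \<phi> x = 0} = H"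

text \<open>For \<open>H \<subseteq> K\<close>, the map \<open>A / H \<rightarrow> A / K\<close> induced by the identity of \<open>A\<close>, in terms of the
  projections \<open>\<phi> : A \<rightarrow> A / H\<close> and \<open>\<psi> : A \<rightarrow> A / K\<close>.\<close>

definition induced_map :: "('a \<Rightarrow> 'b) \<Rightarrow> ('a \<Rightarrow> 'c) \<Rightarrow> 'b \<Rightarrow> 'c" where
  "induced_map \<phi> \<psi> = (THE h. \<forall>x. h (\<phi> x) = \<psi> x)"

lemma induced_map_apply:
  assumes "quotient_projection \<phi> H" "quotient_projection \<psi> K" "H \<subseteq> K"
  shows "induced_map \<phi> \<psi> (\<phi> x) = \<psi> x"
proof -
  have a: "Modules.additive \<phi>" "Modules.additive \<psi>" and s: "surj \<phi>"
    using assms by (auto simp: quotient_projection_def)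
  have wd: "\<psi> x = \<psi> y" if "\<phi> x = \<phi> y" for x y
  proof -
    have "\<phi> (x - y) = 0" using that a by (simp add: Modules.additive.diff)
    then have "\<psi> (x - y) = 0" using assms by (auto simp: quotient_projection_def)
    then show ?thesis using a by (simp add: Modules.additive.diff)
  qed
  have "\<exists>!h. \<forall>x. h (\<phi> x) = \<psi> x"
  proof (rule ex1I[of _ "\<lambda>z. \<psi> (inv \<phi> z)"])
    show "\<forall>x. \<psi> (inv \<phi> (\<phi> x)) = \<psi> x"
      by (intro allI wd) (rule surj_f_inv_f[OF s])
  next
    fix h assume h: "\<forall>x. h (\<phi> x) = \<psi> x"
    show "h = (\<lambda>z. \<psi> (inv \<phi> z))"
    proof
      fix z
      show "h z = \<psi> (inv \<phi> z)" using spec[OF h, of "inv \<phi> z"] by (simp add: surj_f_inv_f[OF s])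
    qed
  qed
  from theI'[OF this] show ?thesis by (simp add: induced_map_def)
qed


section \<open>The real vector space \<open>A \<otimes> \<real>\<close>\<close>

instantiation poly_mapping :: (type, real_vector) real_vector
begin

lift_definition scaleR_poly_mapping :: "real \<Rightarrow> ('a \<Rightarrow>\<^sub>0 'b) \<Rightarrow> 'a \<Rightarrow>\<^sub>0 'b"
  is "\<lambda>r f a. r *\<^sub>R f a"
  by (erule finite_subset[rotated]) auto

instance
  by standard (transfer; simp add: fun_eq_iff algebra_simps)+

end

text \<open>From the presentation of \<open>A\<close> by the generators \<open>[a]\<close> and the relations
  \<open>[a + b] = [a] + [b]\<close>, one obtains \<open>A \<otimes> \<real>\<close> (tensor product over the integers) as the free real
  vector space on the \<open>[a]\<close> modulo the subspace spanned by the same relations.\<close>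

definition tensor_relations :: "('a::ab_group_add \<Rightarrow>\<^sub>0 real) set" where
  "tensor_relations = span {Poly_Mapping.single (a + b) 1
     - Poly_Mapping.single a 1 - Poly_Mapping.single b 1 | a b. True}"

definition tensor_rel :: "('a::ab_group_add \<Rightarrow>\<^sub>0 real) \<Rightarrow> ('a \<Rightarrow>\<^sub>0 real) \<Rightarrow> bool" where
  "tensor_rel f g \<longleftrightarrow> f - g \<in> tensor_relations"

lemma subspace_tensor_relations: "subspace tensor_relations"
  by (simp add: tensor_relations_def)

quotient_type (overloaded) 'a real_tensor = "'a::ab_group_add \<Rightarrow>\<^sub>0 real" / tensor_rel
proof (rule equivpI)
  show "reflp (tensor_rel :: ('a \<Rightarrow>\<^sub>0 real) \<Rightarrow> _)"
    by (auto simp: reflp_def tensor_rel_def subspace_0 subspace_tensor_relations)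
  show "symp (tensor_rel :: ('a \<Rightarrow>\<^sub>0 real) \<Rightarrow> _)"
    unfolding symp_def tensor_rel_def
    by (metis minus_diff_eq subspace_neg subspace_tensor_relations)
  show "transp (tensor_rel :: ('a \<Rightarrow>\<^sub>0 real) \<Rightarrow> _)"
    unfolding transp_def tensor_rel_def
  proof (intro allI impI)
    fix p q r :: "'a \<Rightarrow>\<^sub>0 real"
    assume "p - q \<in> tensor_relations" "q - r \<in> tensor_relations"
    then have "(p - q) + (q - r) \<in> tensor_relations"
      by (rule subspace_add[OF subspace_tensor_relations])
    then show "p - r \<in> tensor_relations" by simp
  qed
qed

lemma abs_rep_real_tensor: "abs_real_tensor (rep_real_tensor t) = t"
  by (rule Quotient3_abs_rep[OF Quotient3_real_tensor])

instantiation real_tensor :: (ab_group_add) real_vector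
begin

lift_definition zero_real_tensor :: "'a real_tensor" is 0 .

lift_definition plus_real_tensor :: "'a real_tensor \<Rightarrow> 'a real_tensor \<Rightarrow> 'a real_tensor" is "(+)"
  unfolding tensor_rel_def by (auto simp: add_diff_add subspace_add subspace_tensor_relations)

lift_definition uminus_real_tensor :: "'a real_tensor \<Rightarrow> 'a real_tensor" is uminus
proof -
  fix p q :: "'a \<Rightarrow>\<^sub>0 real"
  assume "tensor_rel p q"
  then have "- (p - q) \<in> tensor_relations"
    unfolding tensor_rel_def by (rule subspace_neg[OF subspace_tensor_relations])
  then show "tensor_rel (- p) (- q)" by (simp add: tensor_rel_def)
qed

lift_definition minus_real_tensor :: "'a real_tensor \<Rightarrow> 'a real_tensor \<Rightarrow> 'a real_tensor" is "(-)"
proof -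
  fix p q r s :: "'a \<Rightarrow>\<^sub>0 real"
  assume "tensor_rel p q" "tensor_rel r s"
  then have "(p - q) - (r - s) \<in> tensor_relations"
    unfolding tensor_rel_def by (rule subspace_diff[OF subspace_tensor_relations])
  also have "(p - q) - (r - s) = (p - r) - (q - s)" by simp
  finally show "tensor_rel (p - r) (q - s)" by (simp add: tensor_rel_def)
qed

lift_definition scaleR_real_tensor :: "real \<Rightarrow> 'a real_tensor \<Rightarrow> 'a real_tensor" is "scaleR"
  unfolding tensor_rel_def
  by (simp flip: scaleR_diff_right add: subspace_scale subspace_tensor_relations)

instance
  by standard
    (transfer; simp add: tensor_rel_def subspace_0 subspace_tensor_relations algebra_simps)+

end

text \<open>The canonical map \<open>a \<mapsto> a \<otimes> 1\<close>.\<close>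

lift_definition tensor_one :: "'a::ab_group_add \<Rightarrow> 'a real_tensor"
  is "\<lambda>a. Poly_Mapping.single a 1" .

lemma tensor_one_add: "tensor_one (a + b) = tensor_one a + tensor_one b"
  by transfer (auto simp: tensor_rel_def tensor_relations_def diff_diff_eq intro!: span_base)

definition formal_lift :: "('a \<Rightarrow> 'v::real_vector) \<Rightarrow> ('a \<Rightarrow>\<^sub>0 real) \<Rightarrow> 'v" where
  "formal_lift f p = (\<Sum>a\<in>Poly_Mapping.keys p. Poly_Mapping.lookup p a *\<^sub>R f a)"

text \<open>The linear map \<open>\<Sum> c\<^sub>a (a \<otimes> 1) \<mapsto> \<Sum> c\<^sub>a f(a)\<close> induced by an additive map \<open>f\<close> to a real vector
  space; additivity makes it independent of the chosen representative, see
  \<open>tensor_lift_universal\<close> below.\<close>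

definition tensor_lift :: "('a::ab_group_add \<Rightarrow> 'v::real_vector) \<Rightarrow> 'a real_tensor \<Rightarrow> 'v" where
  "tensor_lift f t = formal_lift f (rep_real_tensor t)"

definition tensor_map :: "('a::ab_group_add \<Rightarrow> 'b::ab_group_add) \<Rightarrow> 'a real_tensor \<Rightarrow> 'b real_tensor"
  where "tensor_map f = tensor_lift (\<lambda>a. tensor_one (f a))"

lemma formal_lift_superset:
  "finite S \<Longrightarrow> Poly_Mapping.keys p \<subseteq> S \<Longrightarrow>
     formal_lift f p = (\<Sum>a\<in>S. Poly_Mapping.lookup p a *\<^sub>R f a)"
  unfolding formal_lift_def by (rule sum.mono_neutral_left) (auto simp: in_keys_iff)

lemma lookup_scaleR:
  "Poly_Mapping.lookup (r *\<^sub>R p) a = r *\<^sub>R Poly_Mapping.lookup (p :: 'a \<Rightarrow>\<^sub>0 'b::real_vector) a"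
  by transfer simp

lemma linear_formal_lift: "linear (formal_lift f)"
proof (rule linearI)
  fix p q :: "'a \<Rightarrow>\<^sub>0 real"
  let ?S = "Poly_Mapping.keys p \<union> Poly_Mapping.keys q \<union> Poly_Mapping.keys (p + q)"
  have "formal_lift f r = (\<Sum>a\<in>?S. Poly_Mapping.lookup r a *\<^sub>R f a)" if "r \<in> {p, q, p + q}" for r
    using that by (intro formal_lift_superset) auto
  then show "formal_lift f (p + q) = formal_lift f p + formal_lift f q"
    by (simp add: lookup_add scaleR_add_left sum.distrib)
next
  fix c and p :: "'a \<Rightarrow>\<^sub>0 real"
  let ?S = "Poly_Mapping.keys p \<union> Poly_Mapping.keys (c *\<^sub>R p)"
  have "formal_lift f r = (\<Sum>a\<in>?S. Poly_Mapping.lookup r a *\<^sub>R f a)" if "r \<in> {p, c *\<^sub>R p}" for r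
    using that by (intro formal_lift_superset) auto
  then show "formal_lift f (c *\<^sub>R p) = c *\<^sub>R formal_lift f p"
    by (simp add: lookup_scaleR scaleR_sum_right)
qed

lemma formal_lift_single [simp]: "formal_lift f (Poly_Mapping.single a c) = c *\<^sub>R f a"
  by (simp add: formal_lift_def)

lemma formal_lift_cong:
  assumes "Modules.additive f" "tensor_rel p q"
  shows "formal_lift f p = formal_lift f q"
proof -
  have "formal_lift f r = 0" if "r \<in> tensor_relations" for r
    using that unfolding tensor_relations_def
  proof (rule linear_eq_0_on_span[OF linear_formal_lift, rotated])
    fix r :: "'a \<Rightarrow>\<^sub>0 real"
    assume "r \<in> {Poly_Mapping.single (a + b) 1
     - Poly_Mapping.single a 1 - Poly_Mapping.single b 1 | a b. True}"
    then show "formal_lift f r = 0"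
      using assms(1) by (auto simp: linear_diff[OF linear_formal_lift] Modules.additive.add)
  qed
  from this[of "p - q"] assms(2) show ?thesis
    by (simp add: tensor_rel_def linear_diff[OF linear_formal_lift])
qed

lemma tensor_lift_abs:
  assumes "Modules.additive f"
  shows "tensor_lift f (abs_real_tensor p) = formal_lift f p"
proof -
  have "tensor_rel (rep_real_tensor (abs_real_tensor p)) p"
    by (simp add: real_tensor.abs_eq_iff[symmetric] abs_rep_real_tensor)
  from formal_lift_cong[OF assms this] show ?thesis
    by (simp add: tensor_lift_def)
qed

theorem tensor_lift_universal:
  fixes f :: "'a::ab_group_add \<Rightarrow> 'v::real_vector"
  assumes "Modules.additive f"
  shows "linear (tensor_lift f)"
    and "tensor_lift f (tensor_one a) = f a"
    and "\<And>g. linear g \<Longrightarrow> (\<And>a. g (tensor_one a) = f a) \<Longrightarrow> g = tensor_lift f"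
proof -
  note lin = linear_formal_lift[of f]
  show L: "linear (tensor_lift f)"
  proof (rule linearI)
    fix s t :: "'a real_tensor" and c :: real
    obtain p q where "s = abs_real_tensor p" "t = abs_real_tensor q"
      using abs_rep_real_tensor by metis
    then show "tensor_lift f (s + t) = tensor_lift f s + tensor_lift f t"
      "tensor_lift f (c *\<^sub>R s) = c *\<^sub>R tensor_lift f s"
      by (simp_all add: plus_real_tensor.abs_eq scaleR_real_tensor.abs_eq tensor_lift_abs assms
          linear_add[OF lin] linear_scale[OF lin])
  qed
  show E: "tensor_lift f (tensor_one a) = f a" for a
    by (simp add: tensor_one.abs_eq tensor_lift_abs assms)
  fix g :: "'a real_tensor \<Rightarrow> 'v"
  assume g: "linear g" "\<And>a. g (tensor_one a) = f a"
  have lin_abs: "linear (abs_real_tensor :: ('a \<Rightarrow>\<^sub>0 real) \<Rightarrow> 'a real_tensor)"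
    by (rule linearI) (simp_all add: plus_real_tensor.abs_eq scaleR_real_tensor.abs_eq)
  show "g = tensor_lift f"
  proof
    fix t :: "'a real_tensor"
    obtain p where t: "t = abs_real_tensor p"
      using abs_rep_real_tensor by metis
    have p: "p = (\<Sum>a\<in>Poly_Mapping.keys p. Poly_Mapping.lookup p a *\<^sub>R Poly_Mapping.single a 1)"
    proof (rule poly_mapping_eqI)
      fix k
      have "(\<Sum>a\<in>Poly_Mapping.keys p. Poly_Mapping.lookup p a * (if a = k then 1 else 0)) =
          (\<Sum>a\<in>Poly_Mapping.keys p. if a = k then Poly_Mapping.lookup p a else 0)"
        by (rule sum.cong) auto
      also have "\<dots> = Poly_Mapping.lookup p k" by (simp add: in_keys_iff)
      finally show "Poly_Mapping.lookup p k = Poly_Mapping.lookup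
          (\<Sum>a\<in>Poly_Mapping.keys p. Poly_Mapping.lookup p a *\<^sub>R Poly_Mapping.single a 1) k"
        by (simp add: lookup_sum lookup_scaleR lookup_single when_def)
    qed
    have "t = abs_real_tensor
        (\<Sum>a\<in>Poly_Mapping.keys p. Poly_Mapping.lookup p a *\<^sub>R Poly_Mapping.single a 1)"
      unfolding t by (rule arg_cong[OF p])
    also have "\<dots> = (\<Sum>a\<in>Poly_Mapping.keys p. Poly_Mapping.lookup p a *\<^sub>R tensor_one a)"
      unfolding tensor_one.abs_eq linear_scale[OF lin_abs, symmetric]
      by (rule linear_sum[OF lin_abs])
    finally have "t = (\<Sum>a\<in>Poly_Mapping.keys p. Poly_Mapping.lookup p a *\<^sub>R tensor_one a)" .
    then show "g t = tensor_lift f t"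
      by (simp add: linear_sum[OF g(1)] linear_scale[OF g(1)] linear_sum[OF L] linear_scale[OF L]
          g(2) E)
  qed
qed


section \<open>Root data\<close>

text \<open>A split connected reductive group \<open>G\<close> over the ring of integers of a local field, with split
  maximal torus \<open>T\<close>, enters through its root datum; the reduced root data are exactly those that
  occur. The type \<open>'c\<close> is the character lattice \<open>X\<^sup>*(T)\<close>, the type \<open>'x\<close> the cocharacter lattice
  \<open>X\<^sub>*(T)\<close>, and \<open>R\<close> the set of roots of \<open>T\<close> in \<open>G\<close>. The function \<open>coroot\<close> matters only on \<open>R\<close>.\<close>

locale root_datum =
  fixes pairing :: "'c::ab_group_add \<Rightarrow> 'x::ab_group_add \<Rightarrow> int"
    and R :: "'c set"
    and coroot :: "'c \<Rightarrow> 'x"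
  assumes free_characters: "finite_free TYPE('c)"
    and free_cocharacters: "finite_free TYPE('x)"
    and pairing_add_left: "pairing (\<eta> + \<theta>) x = pairing \<eta> x + pairing \<theta> x"
    and pairing_add_right: "pairing \<eta> (x + y) = pairing \<eta> x + pairing \<eta> y"
    and perfect_left: "bij_betw (\<lambda>\<eta> x. pairing \<eta> x) UNIV {f. Modules.additive f}"
    and perfect_right: "bij_betw (\<lambda>x \<eta>. pairing \<eta> x) UNIV {f. Modules.additive f}"
    and finite_roots: "finite R"
    and inj_coroot: "inj_on coroot R"
    and pairing_root_coroot: "\<alpha> \<in> R \<Longrightarrow> pairing \<alpha> (coroot \<alpha>) = 2"
    and reflect_roots: "\<alpha> \<in> R \<Longrightarrow> \<beta> \<in> R \<Longrightarrow> \<beta> - zmult (pairing \<beta> (coroot \<alpha>)) \<alpha> \<in> R"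
    and reflect_coroots: "\<alpha> \<in> R \<Longrightarrow> \<beta> \<in> R \<Longrightarrow>
          coroot \<beta> - zmult (pairing \<alpha> (coroot \<beta>)) (coroot \<alpha>) \<in> coroot ` R"

definition reduced_roots :: "'c::ab_group_add set \<Rightarrow> bool" where
  "reduced_roots R \<longleftrightarrow> (\<forall>\<alpha>\<in>R. \<forall>\<beta>\<in>R. \<forall>m n. m \<noteq> 0 \<and> zmult m \<beta> = zmult n \<alpha> \<longrightarrow> \<beta> = \<alpha> \<or> \<beta> = - \<alpha>)"

text \<open>The roots span \<open>X\<^sup>*(T) \<otimes> \<rat>\<close>.\<close>

definition semisimple_roots :: "'c::ab_group_add set \<Rightarrow> bool" where
  "semisimple_roots R \<longleftrightarrow> (\<forall>\<eta>. \<exists>n>0. zmult n \<eta> \<in> zmod.span R)"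

definition coroot_lattice :: "('c \<Rightarrow> 'x::ab_group_add) \<Rightarrow> 'c set \<Rightarrow> 'x set" where
  "coroot_lattice coroot S = zmod.span (coroot ` S)"

definition simply_connected_datum :: "'c set \<Rightarrow> ('c \<Rightarrow> 'x::ab_group_add) \<Rightarrow> bool" where
  "simply_connected_datum R coroot \<longleftrightarrow> coroot_lattice coroot R = UNIV"

text \<open>A parabolic subgroup containing \<open>T\<close> is encoded by the set of roots of \<open>T\<close> in it. The sets that
  occur are exactly the closed \<open>S \<subseteq> R\<close> with \<open>S \<union> - S = R\<close>; Borel subgroups are those with
  \<open>S \<inter> - S = {}\<close>, and inclusion of subgroups is inclusion of sets. The roots of the Levi subgroup
  containing \<open>T\<close> are \<open>S \<inter> - S\<close>.\<close>

definition parabolic_roots :: "'c::ab_group_add set \<Rightarrow> 'c set \<Rightarrow> bool" where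
  "parabolic_roots R S \<longleftrightarrow>
     S \<union> uminus ` S = R \<and> (\<forall>\<alpha>\<in>S. \<forall>\<beta>\<in>S. \<alpha> + \<beta> \<in> R \<longrightarrow> \<alpha> + \<beta> \<in> S)"

definition levi_roots :: "'c::ab_group_add set \<Rightarrow> 'c set" where
  "levi_roots S = S \<inter> uminus ` S"

definition borel_roots :: "'c::ab_group_add set \<Rightarrow> 'c set \<Rightarrow> bool" where
  "borel_roots R S \<longleftrightarrow> parabolic_roots R S \<and> levi_roots S = {}"

definition semisimple_rank_one :: "'c::ab_group_add set \<Rightarrow> 'c set \<Rightarrow> bool" where
  "semisimple_rank_one R S \<longleftrightarrow> (\<exists>\<alpha>\<in>R. levi_roots S = {\<alpha>, - \<alpha>})"

definition dominant :: "('c \<Rightarrow> 'x \<Rightarrow> int) \<Rightarrow> 'c set \<Rightarrow> 'x \<Rightarrow> bool" where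
  "dominant pairing B \<mu> \<longleftrightarrow> (\<forall>\<alpha>\<in>B. pairing \<alpha> \<mu> \<ge> 0)"

definition coreflection ::
  "('c \<Rightarrow> 'x::ab_group_add \<Rightarrow> int) \<Rightarrow> ('c \<Rightarrow> 'x) \<Rightarrow> 'c \<Rightarrow> 'x \<Rightarrow> 'x" where
  "coreflection pairing coroot \<alpha> x = x - zmult (pairing \<alpha> x) (coroot \<alpha>)"

text \<open>Reflections are involutions, so their products already form a group.\<close>

inductive_set weyl_group :: "('c \<Rightarrow> 'x::ab_group_add \<Rightarrow> int) \<Rightarrow> 'c set \<Rightarrow> ('c \<Rightarrow> 'x) \<Rightarrow> ('x \<Rightarrow> 'x) set"
  for pairing R coroot where
  id: "id \<in> weyl_group pairing R coroot"
| reflection: "\<alpha> \<in> R \<Longrightarrow> w \<in> weyl_group pairing R coroot \<Longrightarrow>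
    coreflection pairing coroot \<alpha> \<circ> w \<in> weyl_group pairing R coroot"

definition conv_orbit ::
  "('c \<Rightarrow> 'x::ab_group_add \<Rightarrow> int) \<Rightarrow> 'c set \<Rightarrow> ('c \<Rightarrow> 'x) \<Rightarrow> 'x \<Rightarrow> 'x real_tensor set" where
  "conv_orbit pairing R coroot \<mu> =
     convex hull {tensor_one (w \<mu>) | w. w \<in> weyl_group pairing R coroot}"

definition P_set ::
  "('c \<Rightarrow> 'x::ab_group_add \<Rightarrow> int) \<Rightarrow> 'c set \<Rightarrow> ('c \<Rightarrow> 'x) \<Rightarrow> ('x \<Rightarrow> 'g) \<Rightarrow> 'x \<Rightarrow> 'x set" where
  "P_set pairing R coroot \<phi>\<^sub>G \<mu> =
     {\<nu>. \<phi>\<^sub>G \<nu> = \<phi>\<^sub>G \<mu> \<and> tensor_one \<nu> \<in> conv_orbit pairing R coroot \<mu>}"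

end

theory Submission
  imports Defs
begin

text \<open>Since \<open>G\<close> is simply connected, \<open>X\<close> is the coroot lattice and \<open>X\<^sub>G = 0\<close>. Let \<open>\<alpha>\<close> be a root of \<open>M\<close>,
  let \<open>x\<close> lift \<open>\<nu>\<^sub>1\<close>, and let \<open>C\<close> be the hull of the orbit of \<open>\<mu>\<close>. The points of \<open>C\<close> above \<open>\<nu>\<^sub>1\<close> form
  a segment in the direction of the coroot \<open>a\<close> of \<open>\<alpha>\<close> that is stable under \<open>s\<^sub>\<alpha>\<close>, so its midpoint \<open>u / 2\<close>,
  where \<open>u = x + s\<^sub>\<alpha> x\<close>, lies in \<open>C\<close>. If \<open>\<langle>\<alpha>, x\<rangle>\<close> is even, the midpoint is a lattice point. Otherwise
  \<open>\<nu> = (u + a) / 2\<close> is a lattice point, and it has to be shown to lie in \<open>C\<close>.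

  As \<open>\<langle>\<alpha>, u\<rangle> = 0\<close>, there is a chamber in which \<open>u\<close> is dominant and \<open>a\<close> is simple. Let \<open>m\<close> be the
  dominant point of the orbit. Comparing integral coordinates in the basis of simple coroots, \<open>u / 2 \<in> C\<close>
  gives \<open>\<nu> \<le> m\<close>. Starting from \<open>\<kappa> = m\<close>, one subtracts simple coroots \<open>d\<close> from \<open>\<kappa>\<close>, keeping
  \<open>\<nu> \<le> \<kappa>\<close> and \<open>\<kappa> \<in> C\<close>, until \<open>\<kappa> = \<nu>\<close>: a step stays in \<open>C\<close> if \<open>\<langle>\<kappa>, d\<rangle> > 0\<close>, and positivity of the
  invariant form, applied to \<open>\<kappa> - u / 2\<close>, shows that some \<open>d\<close> in the support of \<open>\<kappa> - \<nu>\<close> is of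
  this kind.\<close>

section \<open>Additive maps and tensor products\<close>

lemma additive_zmult:
  assumes "Modules.additive f"
  shows "f (zmult k x) = zmult k (f x)"
proof (induction k rule: int_induct[where k = 0])
  case base
  show ?case using assms by (simp add: Modules.additive.zero)
next
  case (step1 i)
  then show ?case
    using assms zmult_Suc[of i x] zmult_Suc[of i "f x"] by (simp add: Modules.additive.add)
next
  case (step2 i)
  have "f (zmult i x) = f (zmult (i - 1) x) + f x"
    using assms zmult_Suc[of "i - 1" x] by (simp add: Modules.additive.add)
  then show ?case using step2 zmult_Suc[of "i - 1" "f x"] by simp
qed

lemma zmult_int [simp]: "zmult k (m :: int) = k * m"
proof (induction k rule: int_induct[where k = 0])
  case (step1 i)
  then show ?case using zmult_Suc[of i m] by (simp add: algebra_simps)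
next
  case (step2 i)
  then show ?case using zmult_Suc[of "i - 1" m] by (simp add: algebra_simps)
qed simp

lemma zmult_scaleR: "zmult k (v :: 'v::real_vector) = of_int k *\<^sub>R v"
proof (induction k rule: int_induct[where k = 0])
  case (step1 i)
  then show ?case using zmult_Suc[of i v] by (simp add: scaleR_add_left)
next
  case (step2 i)
  then show ?case using zmult_Suc[of "i - 1" v] by (simp add: scaleR_diff_left algebra_simps)
qed simp

lemma tensor_one_additive: "Modules.additive tensor_one"
  by (simp add: Modules.additive_def tensor_one_add)

lemma tensor_one_zmult: "tensor_one (zmult k x) = of_int k *\<^sub>R tensor_one x"
  by (simp add: additive_zmult[OF tensor_one_additive] zmult_scaleR)

lemma tensor_map_linear:
  assumes "Modules.additive f"
  shows "linear (tensor_map f)" "tensor_map f (tensor_one a) = tensor_one (f a)"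
proof -
  have "Modules.additive (\<lambda>a. tensor_one (f a))"
    using assms by (simp add: Modules.additive_def tensor_one_add)
  from tensor_lift_universal(1,2)[OF this]
  show "linear (tensor_map f)" "tensor_map f (tensor_one a) = tensor_one (f a)"
    by (auto simp: tensor_map_def)
qed

text \<open>Exactness of \<open>H \<otimes> \<real> \<rightarrow> A \<otimes> \<real> \<rightarrow> A / H \<otimes> \<real>\<close> in the middle, tested against maps out of \<open>A\<close>.\<close>

lemma tensor_lift_eq_of_tensor_map_eq:
  fixes f :: "'a::ab_group_add \<Rightarrow> 'v::real_vector"
  assumes \<phi>: "quotient_projection \<phi> H" and f: "Modules.additive f" and H: "\<And>x. x \<in> H \<Longrightarrow> f x = 0"
    and eq: "tensor_map \<phi> c = tensor_map \<phi> d"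
  shows "tensor_lift f c = tensor_lift f d"
proof -
  have \<phi>_add: "Modules.additive \<phi>" and surj: "surj \<phi>" and ker: "{x. \<phi> x = 0} = H"
    using \<phi> by (auto simp: quotient_projection_def)
  \<comment> \<open>The map induced on the quotient, through chosen preimages; the choice is
    immaterial because \<open>f\<close> vanishes on \<open>H\<close>.\<close>
  define g where "g z = f (inv \<phi> z)" for z
  have g: "g (\<phi> x) = f x" for x
  proof -
    have "\<phi> (inv \<phi> (\<phi> x) - x) = 0"
      by (simp add: Modules.additive.diff[OF \<phi>_add] surj_f_inv_f[OF surj])
    then have "inv \<phi> (\<phi> x) - x \<in> H" using ker by auto
    from H[OF this] show ?thesis by (simp add: g_def Modules.additive.diff[OF f])
  qed
  have "Modules.additive g"
    unfolding Modules.additive_def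
  proof (intro allI)
    fix x y
    obtain a b where "x = \<phi> a" "y = \<phi> b" using surj by (metis surjD)
    then show "g (x + y) = g x + g y"
      using g[of "a + b"] by (simp add: g Modules.additive.add[OF f] Modules.additive.add[OF \<phi>_add])
  qed
  note G = tensor_lift_universal(1,2)[OF this]
  note T = tensor_map_linear[OF \<phi>_add]
  \<comment> \<open>Both sides are linear and agree on every \<open>tensor_one a\<close>, so the
    universal property identifies them.\<close>
  have "tensor_lift g \<circ> tensor_map \<phi> = tensor_lift f"
    by (rule tensor_lift_universal(3)[OF f])
      (simp_all add: linear_compose[OF T(1) G(1)] T(2) G(2) g)
  then show ?thesis using eq by (metis o_apply)
qed

section \<open>Root systems in a lattice with an invariant form\<close>

text \<open>Roots do not appear: given the positive definite form, the root belonging to a coroot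
  \<open>a\<close> is the functional sending x to 2 (a, x) / (a, a), and \<open>form_dvd\<close>
  makes it integral. \<open>span_coroots\<close> expresses simple connectedness.\<close>

locale coroot_system =
  fixes form :: "'x::ab_group_add \<Rightarrow> 'x \<Rightarrow> int"
    and \<Phi> :: "'x set"
  assumes form_add_left: "form (x + y) z = form x z + form y z"
    and form_sym: "form x y = form y x"
    and form_pos: "x \<noteq> 0 \<Longrightarrow> form x x > 0"
    and finite_coroots: "finite \<Phi>"
    and zero_notin: "0 \<notin> \<Phi>"
    and form_dvd: "a \<in> \<Phi> \<Longrightarrow> form a a dvd 2 * form a x"
    and refl_closed_raw: "a \<in> \<Phi> \<Longrightarrow> b \<in> \<Phi> \<Longrightarrow> b - zmult (2 * form a b div form a a) a \<in> \<Phi>"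
    and span_coroots: "zmod.span \<Phi> = UNIV"
    and reduced: "a \<in> \<Phi> \<Longrightarrow> b \<in> \<Phi> \<Longrightarrow> m \<noteq> 0 \<Longrightarrow> zmult m b = zmult k a \<Longrightarrow> b = a \<or> b = - a"
begin

definition cartan :: "'x \<Rightarrow> 'x \<Rightarrow> int" where
  "cartan a x = 2 * form a x div form a a"

definition refl :: "'x \<Rightarrow> 'x \<Rightarrow> 'x" where
  "refl a x = x - zmult (cartan a x) a"

text \<open>Weyl group elements are kept as words in reflections, so that word length is available
  for induction.\<close>

abbreviation act :: "'x list \<Rightarrow> 'x \<Rightarrow> 'x" where
  "act as x \<equiv> foldr refl as x"

lemma form_additive_left: "Modules.additive (\<lambda>x. form x y)"
  by (simp add: Modules.additive_def form_add_left)

lemma form_add_right: "form x (y + z) = form x y + form x z"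
  by (metis form_sym form_add_left)

lemma form_additive_right: "Modules.additive (form x)"
  by (simp add: Modules.additive_def form_add_right)

lemmas form_simps = form_add_left form_add_right
  Modules.additive.diff[OF form_additive_left] Modules.additive.diff[OF form_additive_right]
  Modules.additive.minus[OF form_additive_left] Modules.additive.minus[OF form_additive_right]
  additive_zmult[OF form_additive_left] additive_zmult[OF form_additive_right]

lemma form_zero [simp]: "form 0 x = 0" "form x 0 = 0"
  using Modules.additive.zero[OF form_additive_left] Modules.additive.zero[OF form_additive_right]
  by auto

lemma form_nonneg: "form x x \<ge> 0"
  using form_pos[of x] by (cases "x = 0") auto

lemma form_sum_left: "form (\<Sum>i\<in>A. f i) y = (\<Sum>i\<in>A. form (f i) y)"
  by (induction A rule: infinite_finite_induct) (auto simp: form_add_left)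

lemma form_sum_right: "form y (\<Sum>i\<in>A. f i) = (\<Sum>i\<in>A. form y (f i))"
  by (induction A rule: infinite_finite_induct) (auto simp: form_add_right)

lemma coroot_norm_pos: "a \<in> \<Phi> \<Longrightarrow> form a a > 0"
  using form_pos[of a] zero_notin by auto

lemma cartan_form: "a \<in> \<Phi> \<Longrightarrow> cartan a x * form a a = 2 * form a x"
  unfolding cartan_def using form_dvd by (metis dvd_div_mult_self)

lemma cartan_eqI: "a \<in> \<Phi> \<Longrightarrow> k * form a a = 2 * form a x \<Longrightarrow> cartan a x = k"
  using cartan_form[of a x] coroot_norm_pos[of a]
  by (metis less_irrefl mult_right_cancel)

lemma cartan_add: "a \<in> \<Phi> \<Longrightarrow> cartan a (x + y) = cartan a x + cartan a y"
  by (rule cartan_eqI) (simp_all add: distrib_right cartan_form form_simps)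

lemma cartan_pos_iff: "a \<in> \<Phi> \<Longrightarrow> cartan a x > 0 \<longleftrightarrow> form a x > 0"
  using cartan_form[of a x] coroot_norm_pos[of a] zero_less_mult_iff[of "cartan a x" "form a a"]
  by linarith

lemma cartan_nonneg_iff: "a \<in> \<Phi> \<Longrightarrow> cartan a x \<ge> 0 \<longleftrightarrow> form a x \<ge> 0"
  using cartan_form[of a x] coroot_norm_pos[of a] zero_le_mult_iff[of "cartan a x" "form a a"]
  by linarith

lemma refl_closed: "a \<in> \<Phi> \<Longrightarrow> b \<in> \<Phi> \<Longrightarrow> refl a b \<in> \<Phi>"
  unfolding refl_def cartan_def by (rule refl_closed_raw)

lemma refl_additive: "a \<in> \<Phi> \<Longrightarrow> Modules.additive (refl a)"
  by (simp add: Modules.additive_def refl_def cartan_add zmult_add_left)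

lemma cartan_self: "a \<in> \<Phi> \<Longrightarrow> cartan a a = 2"
  by (rule cartan_eqI) simp_all

lemma refl_self: "a \<in> \<Phi> \<Longrightarrow> refl a a = - a"
proof -
  assume "a \<in> \<Phi>"
  moreover have "zmult 2 a = a + a" using zmult_add_left[of 1 1 a] by simp
  ultimately show ?thesis by (simp add: refl_def cartan_self)
qed

lemma refl_refl [simp]:
  assumes "a \<in> \<Phi>"
  shows "refl a (refl a x) = x"
proof -
  note A = refl_additive[OF assms]
  have "refl a (refl a x) = refl a (x - zmult (cartan a x) a)" by (simp only: refl_def[of a x])
  also have "\<dots> = refl a x - zmult (cartan a x) (refl a a)"
    by (simp add: Modules.additive.diff[OF A] additive_zmult[OF A])
  also have "\<dots> = x" by (simp add: refl_self[OF assms] refl_def[of a x])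
  finally show ?thesis .
qed

lemma form_refl: "a \<in> \<Phi> \<Longrightarrow> form (refl a x) (refl a y) = form x y"
proof -
  assume a: "a \<in> \<Phi>"
  have "form (refl a x) (refl a y) = form x y - cartan a y * form x a - cartan a x * form a y
      + cartan a x * cartan a y * form a a"
    unfolding refl_def by (simp add: form_simps algebra_simps)
  moreover have "cartan a x * cartan a y * form a a = cartan a x * (2 * form a y)"
    using cartan_form[OF a, of y] by (simp add: mult.assoc)
  moreover have "cartan a x * form a y = cartan a y * form a x"
  proof -
    have "form a a * (cartan a x * form a y) = form a a * (cartan a y * form a x)"
      using cartan_form[OF a, of x] cartan_form[OF a, of y]
      by (metis mult.assoc mult.commute)
    then show ?thesis using coroot_norm_pos[OF a] by simp
  qed
  ultimately show ?thesis by (simp add: form_sym[of x a])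
qed

lemma neg_closed: "a \<in> \<Phi> \<Longrightarrow> - a \<in> \<Phi>"
  using refl_closed[of a a] refl_self[of a] by simp

lemma refl_minus: "a \<in> \<Phi> \<Longrightarrow> refl (- a) = refl a"
proof
  fix x assume "a \<in> \<Phi>"
  then have "cartan (- a) x = - cartan a x"
    by (intro cartan_eqI) (simp_all add: neg_closed form_simps cartan_form)
  then show "refl (- a) x = refl a x" by (simp add: refl_def)
qed

lemma act_additive: "set as \<subseteq> \<Phi> \<Longrightarrow> Modules.additive (act as)"
  by (induction as) (auto simp: Modules.additive_def Modules.additive.add[OF refl_additive])

lemma form_act: "set as \<subseteq> \<Phi> \<Longrightarrow> form (act as x) (act as y) = form x y"
  by (induction as) (auto simp: form_refl)

lemma act_rev: "set as \<subseteq> \<Phi> \<Longrightarrow> act as (act (rev as) x) = x"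
  by (induction as arbitrary: x) auto

lemma cartan_act: "set as \<subseteq> \<Phi> \<Longrightarrow> cartan (act as b) (act as x) = cartan b x"
  by (simp add: cartan_def form_act)

text \<open>Invariance of the form transports Cartan integers, which gives the conjugation rule
  s_(wb) w = w s_b.\<close>

lemma refl_act:
  assumes "set as \<subseteq> \<Phi>" "b \<in> \<Phi>"
  shows "refl (act as b) (act as x) = act as (refl b x)"
  using assms
  by (simp add: refl_def cartan_act Modules.additive.diff[OF act_additive]
      additive_zmult[OF act_additive])

text \<open>If both Cartan integers were at least \<open>2\<close>, then \<open>a - b\<close> would have norm at most \<open>0\<close>.\<close>

lemma coroot_diff:
  assumes "a \<in> \<Phi>" "b \<in> \<Phi>" "a \<noteq> b" "form a b > 0"
  shows "a - b \<in> \<Phi>"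
proof -
  have pos: "cartan a b > 0" "cartan b a > 0"
    using assms cartan_pos_iff form_sym by metis+
  have norm: "form (a - b) (a - b) > 0" using assms by (intro form_pos) simp
  have "cartan a b = 1 \<or> cartan b a = 1"
  proof (rule ccontr)
    assume "\<not> ?thesis"
    then have "cartan a b \<ge> 2" "cartan b a \<ge> 2" using pos by auto
    then have "2 * form a a \<le> cartan a b * form a a" "2 * form b b \<le> cartan b a * form b b"
      using form_nonneg[of a] form_nonneg[of b] by (auto intro: mult_right_mono)
    then have "form a a \<le> form a b" "form b b \<le> form a b"
      using cartan_form[OF assms(1), of b] cartan_form[OF assms(2), of a] form_sym[of a b] by auto
    then show False using norm form_sym[of a b] by (simp add: form_simps)
  qed
  then show ?thesis
  proof
    assume "cartan a b = 1"
    then have "b - a \<in> \<Phi>" using refl_closed[of a b] assms by (simp add: refl_def)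
    then show ?thesis using neg_closed by fastforce
  next
    assume "cartan b a = 1"
    then show ?thesis using refl_closed[of b a] assms by (simp add: refl_def)
  qed
qed

text \<open>In \<open>zmult N x + z\<close>, with \<open>N\<close> larger than every absolute value
  of \<open>form a z\<close>, the integer \<open>form a x\<close> decides the sign unless it
  vanishes; then \<open>z\<close> decides.\<close>

lemma lex_combine:
  assumes "finite F"
  shows "\<exists>w. \<forall>a\<in>F. (form a x > 0 \<longrightarrow> form a w > 0) \<and> (form a x < 0 \<longrightarrow> form a w < 0) \<and>
    (form a x = 0 \<longrightarrow> form a w = form a z)"
proof -
  define N where "N = (\<Sum>a\<in>F. \<bar>form a z\<bar>) + 1"
  have N: "\<bar>form a z\<bar> < N" if "a \<in> F" for a
    using member_le_sum[OF that, of "\<lambda>a. \<bar>form a z\<bar>"] assms unfolding N_def by simp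
  show ?thesis
  proof (intro exI[of _ "zmult N x + z"] ballI conjI impI)
    fix a assume a: "a \<in> F"
    have w: "form a (zmult N x + z) = N * form a x + form a z" by (simp add: form_simps)
    have N0: "N > 0" using N[OF a] by linarith
    show "form a (zmult N x + z) > 0" if "form a x > 0"
    proof -
      have "N * 1 \<le> N * form a x" using that N0 by (intro mult_left_mono) auto
      then show ?thesis using N[OF a] w by linarith
    qed
    show "form a (zmult N x + z) < 0" if "form a x < 0"
    proof -
      have "N * form a x \<le> N * (- 1)" using that N0 by (intro mult_left_mono) auto
      then show ?thesis using N[OF a] w by linarith
    qed
    show "form a (zmult N x + z) = form a z" if "form a x = 0" using that w by simp
  qed
qed

text \<open>Coroots are treated one at a time: \<open>lex_combine\<close> perturbs \<open>y\<close>
  within the orthogonal complement of \<open>a\<close> so that the new coroot pairs nontrivially,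
  without destroying the nonzero pairings already achieved.\<close>

lemma ex_orthogonal_generic:
  assumes a: "a \<in> \<Phi>"
  shows "\<exists>y. form a y = 0 \<and> (\<forall>b\<in>\<Phi> - {a, - a}. form b y \<noteq> 0)"
proof -
  have "\<exists>y. form a y = 0 \<and> (\<forall>b\<in>F. form b y \<noteq> 0)" if "finite F" "F \<subseteq> \<Phi> - {a, - a}" for F
    using that
  proof (induction F rule: finite_induct)
    case empty
    show ?case by (intro exI[of _ 0]) simp
  next
    case (insert b F)
    then obtain y where y: "form a y = 0" "\<forall>b\<in>F. form b y \<noteq> 0" by auto
    \<comment> \<open>The orthogonal projection of \<open>b\<close> away from \<open>a\<close>,
      scaled by \<open>form a a\<close> to stay in the lattice. It is nonzero because
      \<open>b\<close> is not proportional to \<open>a\<close>.\<close>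
    define z where "z = zmult (form a a) b - zmult (form a b) a"
    have z: "form a z = 0" by (simp add: z_def form_simps)
    have "z \<noteq> 0"
      using reduced[of a b "form a a" "form a b"] a insert.prems coroot_norm_pos[OF a]
      by (auto simp: z_def)
    then have "form z z > 0" by (rule form_pos)
    also have "form z z = form a a * form b z"
      by (subst z_def) (simp add: form_simps z)
    finally have bz: "form b z \<noteq> 0" by auto
    obtain w where w: "\<forall>c\<in>insert a (insert b F). (form c y > 0 \<longrightarrow> form c w > 0) \<and>
        (form c y < 0 \<longrightarrow> form c w < 0) \<and> (form c y = 0 \<longrightarrow> form c w = form c z)"
      using lex_combine[of "insert a (insert b F)" y z] insert.hyps by auto
    show ?case
    proof (intro exI[of _ w] conjI ballI)
      show "form a w = 0" using w y z by simp
      fix c assume c: "c \<in> insert b F"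
      show "form c w \<noteq> 0"
      proof (cases "form c y = 0")
        case True
        then have "c = b" using c y by auto
        then show ?thesis using w True bz by simp
      next
        case False
        then show ?thesis using w c by (metis insertCI less_irrefl linorder_cases)
      qed
    qed
  qed
  from this[OF _ subset_refl] show ?thesis using finite_coroots by simp
qed

section \<open>Weyl orbits and their convex hulls\<close>

definition orbit :: "'x \<Rightarrow> 'x set" where
  "orbit \<mu> = {act as \<mu> | as. set as \<subseteq> \<Phi>}"

definition orbit_hull :: "'x \<Rightarrow> 'x real_tensor set" where
  "orbit_hull \<mu> = convex hull (tensor_one ` orbit \<mu>)"

lemma convex_orbit_hull: "convex (orbit_hull \<mu>)"
  by (simp add: orbit_hull_def)

lemma orbit_in_hull: "x \<in> orbit \<mu> \<Longrightarrow> tensor_one x \<in> orbit_hull \<mu>"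
  unfolding orbit_hull_def by (intro hull_inc imageI)

lemma refl_orbit: "a \<in> \<Phi> \<Longrightarrow> x \<in> orbit \<mu> \<Longrightarrow> refl a x \<in> orbit \<mu>"
proof -
  assume "a \<in> \<Phi>" "x \<in> orbit \<mu>"
  then obtain as where "set (a # as) \<subseteq> \<Phi>" "refl a x = act (a # as) \<mu>"
    by (auto simp: orbit_def)
  then show ?thesis unfolding orbit_def by blast
qed

lemma refl_orbit_hull:
  assumes a: "a \<in> \<Phi>" and c: "c \<in> orbit_hull \<mu>"
  shows "tensor_map (refl a) c \<in> orbit_hull \<mu>"
proof -
  note L = tensor_map_linear[OF refl_additive[OF a]]
  have "tensor_map (refl a) ` orbit_hull \<mu> = convex hull (tensor_map (refl a) ` tensor_one ` orbit \<mu>)"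
    unfolding orbit_hull_def by (rule convex_hull_linear_image[OF L(1)])
  also have "\<dots> \<subseteq> orbit_hull \<mu>"
    unfolding orbit_hull_def using refl_orbit[OF a]
    by (intro hull_mono) (auto simp: L(2))
  finally show ?thesis using c by auto
qed

text \<open>The reflected point is \<open>x\<close> minus k times \<open>a\<close> with k at least
  1, so \<open>x - a\<close> lies on the segment joining \<open>x\<close> to it.\<close>

lemma orbit_hull_string:
  assumes a: "a \<in> \<Phi>" and x: "tensor_one x \<in> orbit_hull \<mu>" and pos: "form a x > 0"
  shows "tensor_one (x - a) \<in> orbit_hull \<mu>"
proof -
  define k where "k = real_of_int (cartan a x)"
  have "cartan a x \<ge> 1" using cartan_pos_iff[OF a] pos by (simp add: int_one_le_iff_zero_less)
  then have k: "k \<ge> 1" by (simp add: k_def)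
  have r: "tensor_one (refl a x) \<in> orbit_hull \<mu>"
    using refl_orbit_hull[OF a x] tensor_map_linear(2)[OF refl_additive[OF a]] by simp
  have "tensor_one (refl a x) = tensor_one x - k *\<^sub>R tensor_one a"
    by (simp add: refl_def Modules.additive.diff[OF tensor_one_additive] tensor_one_zmult k_def)
  then have "tensor_one (x - a) = (1 - 1 / k) *\<^sub>R tensor_one x + (1 / k) *\<^sub>R tensor_one (refl a x)"
    using k
    by (simp add: Modules.additive.diff[OF tensor_one_additive] scaleR_diff_left scaleR_diff_right)
  then show ?thesis
    using convexD_alt[OF convex_orbit_hull x r, of "1 / k"] k by simp
qed

text \<open>A half-space containing the orbit contains its hull. This carries coordinate bounds from
  orbit points to midpoints.\<close>

lemma orbit_hull_functional_le:
  assumes f: "Modules.additive f" and bound: "\<And>x. x \<in> orbit \<mu> \<Longrightarrow> f x \<le> (B :: int)"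
    and c: "c \<in> orbit_hull \<mu>"
  shows "tensor_lift (\<lambda>x. real_of_int (f x)) c \<le> of_int B"
proof -
  let ?L = "tensor_lift (\<lambda>x. real_of_int (f x))"
  have "Modules.additive (\<lambda>x. real_of_int (f x))" using f by (simp add: Modules.additive_def)
  note L = tensor_lift_universal(1,2)[OF this]
  have "orbit_hull \<mu> \<subseteq> ?L -` {..of_int B}"
    unfolding orbit_hull_def
  proof (rule hull_minimal)
    show "convex (?L -` {..of_int B})" by (rule convex_linear_vimage[OF L(1)]) simp
  qed (auto simp: L(2) bound)
  then show ?thesis using c by auto
qed

end

section \<open>Positive systems and simple coroots\<close>

text \<open>A chamber is given by a lattice vector \<open>h\<close> off all walls; pairing with
  \<open>h\<close> also serves as the height that drives the inductions.\<close>

locale based_coroot_system = coroot_system +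
  fixes h
  assumes regular: "a \<in> \<Phi> \<Longrightarrow> form a h \<noteq> 0"
begin

definition positive :: "'a set" where
  "positive = {a \<in> \<Phi>. form a h > 0}"

definition simple :: "'a set" where
  "simple = {a \<in> positive. \<not> (\<exists>b\<in>positive. \<exists>c\<in>positive. a = b + c)}"

text \<open>The relation \<open>y - x \<in> cone\<close> is the dominance order.\<close>

inductive_set cone :: "'a set" where
  zero: "0 \<in> cone"
| add: "x \<in> cone \<Longrightarrow> d \<in> simple \<Longrightarrow> x + d \<in> cone"

lemma positive_coroot: "a \<in> positive \<Longrightarrow> a \<in> \<Phi>"
  by (simp add: positive_def)

lemma positive_or_neg: "a \<in> \<Phi> \<Longrightarrow> a \<in> positive \<or> - a \<in> positive"
  using regular[of a] by (auto simp: positive_def neg_closed form_simps)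

lemma simple_positive: "d \<in> simple \<Longrightarrow> d \<in> positive"
  by (simp add: simple_def)

lemma simple_coroot: "d \<in> simple \<Longrightarrow> d \<in> \<Phi>"
  by (simp add: simple_positive positive_coroot)

lemma simple_subset: "simple \<subseteq> \<Phi>"
  using simple_coroot by auto

lemma finite_simple: "finite simple"
  using finite_coroots simple_subset by (rule rev_finite_subset)

lemma simple_height: "d \<in> simple \<Longrightarrow> form d h > 0"
  using simple_positive by (auto simp: positive_def)

text \<open>Otherwise \<open>a - b\<close> is a coroot, and according to its sign either
  \<open>a\<close> or \<open>b\<close> is a sum of two positive coroots.\<close>

lemma simple_obtuse:
  assumes "a \<in> simple" "b \<in> simple" "a \<noteq> b"
  shows "form a b \<le> 0"
proof (rule ccontr)
  assume "\<not> ?thesis"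
  then have "a - b \<in> \<Phi>" using assms by (intro coroot_diff) (auto simp: simple_coroot)
  then have "a - b \<in> positive \<or> b - a \<in> positive" using positive_or_neg by fastforce
  moreover have "a = (a - b) + b" "b = (b - a) + a" by auto
  ultimately show False using assms unfolding simple_def by blast
qed

lemma cone_add: "y \<in> cone \<Longrightarrow> x \<in> cone \<Longrightarrow> x + y \<in> cone"
proof (induction rule: cone.induct)
  case (add y d)
  then show ?case using cone.add[of "x + y" d] by (simp add: add.assoc)
qed simp

lemma simple_in_cone: "d \<in> simple \<Longrightarrow> d \<in> cone"
  using cone.add[OF cone.zero] by simp

text \<open>A decomposable positive coroot splits into two of smaller height.\<close>

lemma positive_in_cone: "a \<in> positive \<Longrightarrow> a \<in> cone"
proof (induction "nat (form a h)" arbitrary: a rule: less_induct)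
  case less
  show ?case
  proof (cases "a \<in> simple")
    case False
    then obtain b c where bc: "b \<in> positive" "c \<in> positive" "a = b + c"
      using less.prems by (auto simp: simple_def)
    then have "form b h > 0" "form c h > 0" by (auto simp: positive_def)
    then have "b \<in> cone" "c \<in> cone" using bc by (auto intro!: less.hyps simp: form_simps)
    then show ?thesis using bc cone_add by simp
  qed (rule simple_in_cone)
qed

lemma cone_zmult: "0 \<le> k \<Longrightarrow> x \<in> cone \<Longrightarrow> zmult k x \<in> cone"
proof (induction k rule: int_ge_induct)
  case base
  show ?case by (simp add: cone.zero)
next
  case (step i)
  then show ?case by (simp add: zmult_Suc cone_add)
qed

text \<open>Moving the negative coefficients of a relation to the other side gives
  \<open>p = q\<close> with disjoint supports. Obtuse angles make \<open>form p q\<close>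
  nonpositive, so \<open>p = 0\<close>; pairing with \<open>h\<close>, which is positive on simple
  coroots, empties both supports.\<close>

lemma simple_independent: "\<not> zmod.dependent simple"
proof
  assume "zmod.dependent simple"
  then obtain u where u: "\<exists>v\<in>simple. u v \<noteq> 0" "(\<Sum>v\<in>simple. zmult (u v) v) = 0"
    using zmod.dependent_finite[OF finite_simple] by auto
  define A where "A = {d \<in> simple. u d > 0}"
  define B where "B = {d \<in> simple. u d < 0}"
  define p where "p = (\<Sum>d\<in>A. zmult (u d) d)"
  define q where "q = (\<Sum>d\<in>B. zmult (- u d) d)"
  have fin: "finite A" "finite B" "A \<inter> B = {}" using finite_simple by (auto simp: A_def B_def)
  have "(\<Sum>v\<in>simple. zmult (u v) v) = (\<Sum>v\<in>A \<union> B. zmult (u v) v)"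
  proof (rule sum.mono_neutral_right[OF finite_simple])
    show "\<forall>v\<in>simple - (A \<union> B). zmult (u v) v = 0"
    proof
      fix v assume "v \<in> simple - (A \<union> B)"
      then have "u v = 0" by (auto simp: A_def B_def)
      then show "zmult (u v) v = 0" by simp
    qed
  qed (auto simp: A_def B_def)
  also have "\<dots> = p - q"
    using fin by (simp add: sum.union_disjoint p_def q_def sum_negf)
  finally have pq: "p = q" using u by simp
  have "form p q = (\<Sum>d\<in>A. \<Sum>e\<in>B. u d * (- u e) * form d e)"
    unfolding p_def q_def form_sum_left form_sum_right
    by (subst sum.swap) (simp add: form_simps algebra_simps)
  also have "\<dots> \<le> 0"
  proof (intro sum_nonpos)
    fix d e assume "d \<in> A" "e \<in> B"
    then have "u d > 0" "- u e > 0" "form d e \<le> 0"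
      by (auto simp: A_def B_def intro!: simple_obtuse)
    then show "u d * (- u e) * form d e \<le> 0" by (intro mult_nonneg_nonpos mult_nonneg_nonneg) auto
  qed
  finally have "p = 0" using pq form_pos[of p] by force
  then have "(\<Sum>d\<in>A. u d * form d h) = 0" "(\<Sum>d\<in>B. - u d * form d h) = 0"
    using pq form_sum_left[of "\<lambda>d. zmult (u d) d" A h] form_sum_left[of "\<lambda>d. zmult (- u d) d" B h]
    by (simp_all add: p_def q_def form_simps)
  moreover have "A = {}" if "(\<Sum>d\<in>A. u d * form d h) = 0"
    using sum_pos[of A "\<lambda>d. u d * form d h"] fin that simple_height by (force simp: A_def)
  moreover have "B = {}" if "(\<Sum>d\<in>B. - u d * form d h) = 0"
    using sum_pos[of B "\<lambda>d. - u d * form d h"] fin that simple_height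
    by (force simp: B_def mult_neg_pos)
  ultimately show False using u by (force simp: A_def B_def)
qed

lemma span_simple: "zmod.span simple = UNIV"
proof -
  have cone: "x \<in> zmod.span simple" if "x \<in> cone" for x
    using that by induction (auto intro: zmod.span_zero zmod.span_add zmod.span_base)
  have "a \<in> zmod.span simple" if "a \<in> \<Phi>" for a
    using positive_or_neg[OF that] cone positive_in_cone zmod.span_neg[of "- a" simple] by auto
  then have "zmod.span \<Phi> \<subseteq> zmod.span simple" by (intro zmod.span_minimal) auto
  then show ?thesis using span_coroots by auto
qed

text \<open>The simple coroots are a basis of the whole lattice over the integers, so these
  coordinates are integers; the parity arguments below rest on this.\<close>

definition coord :: "'a \<Rightarrow> 'a \<Rightarrow> int" where
  "coord d x = zmod.representation simple x d"

lemma coord_additive: "Modules.additive (coord d)"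
  by (simp add: Modules.additive_def coord_def zmod.representation_add[OF simple_independent]
      span_simple)

lemmas coord_simps = Modules.additive.add[OF coord_additive] Modules.additive.diff[OF coord_additive]
  Modules.additive.minus[OF coord_additive] Modules.additive.zero[OF coord_additive]
  additive_zmult[OF coord_additive]

lemma coord_simple: "e \<in> simple \<Longrightarrow> coord d e = (if d = e then 1 else 0)"
  by (simp add: coord_def zmod.representation_basis[OF simple_independent])

lemma sum_coord: "(\<Sum>d\<in>simple. zmult (coord d x) d) = x"
  unfolding coord_def
  by (rule zmod.sum_representation_eq[OF simple_independent]) (auto simp: span_simple finite_simple)

lemma form_coord: "form x y = (\<Sum>d\<in>simple. coord d x * form d y)"
proof -
  have "form x y = form (\<Sum>d\<in>simple. zmult (coord d x) d) y" by (simp only: sum_coord)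
  then show ?thesis by (simp add: form_sum_left form_simps)
qed

lemma coord_cone: "x \<in> cone \<Longrightarrow> coord d x \<ge> 0"
  by (induction rule: cone.induct) (auto simp: coord_simps coord_simple)

lemma coord_positive: "a \<in> positive \<Longrightarrow> coord d a \<ge> 0"
  by (rule coord_cone[OF positive_in_cone])

section \<open>Words in simple reflections\<close>

text \<open>Since \<open>a\<close> is not a multiple of \<open>d\<close>, some coordinate at another
  simple coroot is positive. The reflection changes only the coordinate at \<open>d\<close>, so the
  image cannot be negative.\<close>

lemma refl_simple_positive:
  assumes d: "d \<in> simple" and a: "a \<in> positive" "a \<noteq> d"
  shows "refl d a \<in> positive"
proof -
  have "\<exists>e\<in>simple - {d}. coord e a \<noteq> 0"
  proof (rule ccontr)
    assume "\<not> ?thesis"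
    then have "(\<Sum>e\<in>simple. zmult (coord e a) e) = (\<Sum>e\<in>{d}. zmult (coord e a) e)"
      using d finite_simple by (intro sum.mono_neutral_right) auto
    then have "zmult 1 a = zmult (coord d a) d" using sum_coord[of a] by simp
    then have "a = d \<or> a = - d"
      using reduced[of d a 1 "coord d a"] d a simple_coroot positive_coroot by auto
    then show False using a simple_positive[OF d] by (auto simp: positive_def form_simps)
  qed
  then obtain e where e: "e \<in> simple" "e \<noteq> d" "coord e a > 0"
    using coord_positive[OF a(1)] by (metis DiffE insertI1 order_le_neq_trans)
  have "coord e (refl d a) = coord e a"
    using e d by (simp add: refl_def coord_simps coord_simple)
  then have "\<not> - refl d a \<in> positive"
    using coord_positive[of "- refl d a" e] e by (auto simp: coord_simps)
  then show ?thesis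
    using positive_or_neg[of "refl d a"] refl_closed d a simple_coroot positive_coroot by auto
qed

text \<open>From \<open>form a a > 0\<close>, some simple \<open>d\<close> pairs positively with
  \<open>a\<close>. Unless \<open>a\<close> is simple, reflecting in \<open>d\<close> gives a
  positive coroot of smaller height.\<close>

lemma positive_conj_simple:
  "a \<in> positive \<Longrightarrow> \<exists>ds d. set ds \<subseteq> simple \<and> d \<in> simple \<and> a = act ds d"
proof (induction "nat (form a h)" arbitrary: a rule: less_induct)
  case less
  show ?case
  proof (cases "a \<in> simple")
    case True
    then show ?thesis by (intro exI[of _ "[]"] exI[of _ a]) simp
  next
    case False
    have "form a a > 0" using less.prems coroot_norm_pos positive_coroot by simp
    then have "\<exists>d\<in>simple. coord d a * form d a > 0"
      using form_coord[of a a] sum_nonpos[of simple "\<lambda>d. coord d a * form d a"]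
      by (metis not_less)
    then obtain d where d: "d \<in> simple" "form d a > 0"
      using coord_positive[OF less.prems] by (metis zero_less_mult_iff not_less)
    have p: "refl d a \<in> positive"
      using False less.prems d by (intro refl_simple_positive) auto
    have "form (refl d a) h = form a h - cartan d a * form d h"
      by (simp add: refl_def form_simps)
    also have "cartan d a * form d h > 0"
      using d simple_height simple_coroot cartan_pos_iff by simp
    then have "form a h - cartan d a * form d h < form a h" by simp
    finally have "nat (form (refl d a) h) < nat (form a h)"
      using less.prems by (auto simp: positive_def)
    from less.hyps[OF this p] obtain ds e where
      "set ds \<subseteq> simple" "e \<in> simple" "refl d a = act ds e" by auto
    moreover from this have "a = act (d # ds) e"
      using d simple_coroot refl_refl by (metis foldr.simps(2) o_apply)
    ultimately show ?thesis using d by (intro exI[of _ "d # ds"] exI[of _ e]) simp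
  qed
qed

text \<open>Up to sign, \<open>a\<close> is w d with \<open>d\<close> simple, and its reflection is
  the conjugate w s_d w^-1; reversing a word inverts it.\<close>

lemma refl_simple_word:
  assumes "a \<in> \<Phi>"
  shows "\<exists>ds. set ds \<subseteq> simple \<and> (\<forall>x. refl a x = act ds x)"
proof -
  have *: ?thesis if pos: "b \<in> positive" and b: "refl b = refl a" for b
  proof -
    obtain ds d where d: "set ds \<subseteq> simple" "d \<in> simple" "b = act ds d"
      using positive_conj_simple[OF pos] by auto
    have sub: "set ds \<subseteq> \<Phi>" "d \<in> \<Phi>" using d simple_subset by auto
    have "refl a x = act (ds @ [d] @ rev ds) x" for x
      using refl_act[OF sub, of "act (rev ds) x"] b d(3) act_rev[OF sub(1)] by simp
    then show ?thesis using d by (intro exI[of _ "ds @ [d] @ rev ds"]) auto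
  qed
  show ?thesis using positive_or_neg[OF assms] *[of a] *[of "- a"] refl_minus[OF assms] by auto
qed

lemma act_simple_word:
  "set as \<subseteq> \<Phi> \<Longrightarrow> \<exists>ds. set ds \<subseteq> simple \<and> (\<forall>x. act as x = act ds x)"
proof (induction as)
  case Nil
  show ?case by (intro exI[of _ "[]"]) simp
next
  case (Cons a as)
  then obtain ds es where "set ds \<subseteq> simple" "\<forall>x. act as x = act ds x"
    "set es \<subseteq> simple" "\<forall>x. refl a x = act es x" using refl_simple_word[of a] by auto
  then show ?case by (intro exI[of _ "es @ ds"]) simp
qed

text \<open>The deletion step: the first simple reflection that makes a positive coroot negative is the
  one in that coroot itself.\<close>

lemma act_deletion:
  assumes "set ds \<subseteq> simple" "d \<in> simple" "act ds d \<notin> positive"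
  shows "\<exists>es. set es \<subseteq> simple \<and> length es < length ds \<and> (\<forall>x. act ds (refl d x) = act es x)"
  using assms
proof (induction ds)
  case Nil
  then show ?case by (simp add: simple_positive)
next
  case (Cons e ds)
  have sub: "set ds \<subseteq> \<Phi>" "d \<in> \<Phi>" "e \<in> \<Phi>" using Cons.prems simple_subset by auto
  show ?case
  proof (cases "act ds d \<in> positive")
    case True
    then have "act ds d = e" using refl_simple_positive Cons.prems by auto
    \<comment> \<open>By conjugation, \<open>refl d\<close> on the right becomes
      \<open>refl e\<close> on the left of \<open>act ds\<close>, where it cancels the leading
      \<open>refl e\<close>.\<close>
    then have "act (e # ds) (refl d x) = act ds x" for x
      using refl_act[OF sub(1,2), of x, symmetric] sub by simp
    then show ?thesis using Cons.prems by (intro exI[of _ ds]) auto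
  next
    case False
    then obtain es where "set es \<subseteq> simple" "length es < length ds"
      "\<forall>x. act ds (refl d x) = act es x" using Cons by auto
    then show ?thesis using Cons.prems by (intro exI[of _ "e # es"]) auto
  qed
qed

section \<open>Dominant points of an orbit\<close>

text \<open>Write the word as w s_d. If w d is positive, then m - w s_d m is m - w m plus a
  nonnegative multiple of w d; otherwise deletion gives a shorter word with the same value.\<close>

lemma dominant_maximal:
  assumes m: "\<And>d. d \<in> simple \<Longrightarrow> form d m \<ge> 0" and ds: "set ds \<subseteq> simple"
  shows "m - act ds m \<in> cone"
  using ds
proof (induction "length ds" arbitrary: ds rule: less_induct)
  case less
  show ?case
  proof (cases ds rule: rev_cases)
    case Nil
    then show ?thesis by (simp add: cone.zero)
  next
    case (snoc es d)
    have es: "set es \<subseteq> simple" "d \<in> simple" using less.prems snoc by auto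
    then have sub: "set es \<subseteq> \<Phi>" "d \<in> \<Phi>" using simple_subset by auto
    note A = act_additive[OF sub(1)]
    show ?thesis
    proof (cases "act es d \<in> positive")
      case True
      have "cartan d m \<ge> 0"
        using m[OF es(2)] cartan_nonneg_iff[OF sub(2)] by simp
      then have "(m - act es m) + zmult (cartan d m) (act es d) \<in> cone"
        using less.hyps[of es] es snoc True
        by (intro cone_add[OF cone_zmult[OF _ positive_in_cone]]) auto
      also have "(m - act es m) + zmult (cartan d m) (act es d) = m - act ds m"
        by (simp add: snoc refl_def Modules.additive.diff[OF A] additive_zmult[OF A])
      finally show ?thesis .
    next
      case False
      then obtain fs where "set fs \<subseteq> simple" "length fs < length es" "act ds m = act fs m"
        using act_deletion[OF es] snoc by auto
      then show ?thesis using less.hyps[of fs] snoc by simp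
    qed
  qed
qed

text \<open>An orbit point with maximal pairing with \<open>h\<close> is dominant, since reflecting
  it in a simple coroot cannot increase that pairing.\<close>

lemma ex_dominant:
  "\<exists>as. set as \<subseteq> \<Phi> \<and> (\<forall>d\<in>simple. form d (act as \<mu>) \<ge> 0)"
proof -
  let ?S = "{act as \<mu> | as. set as \<subseteq> \<Phi>}"
  have bound: "2 * form x h \<le> form \<mu> \<mu> + form h h" if "x \<in> ?S" for x
  proof -
    have "form x x = form \<mu> \<mu>" using that form_act by auto
    then show ?thesis
      using form_nonneg[of "x - h"] form_sym[of h x] by (simp add: form_simps)
  qed
  \<comment> \<open>Minimizing \<open>f\<close> maximizes \<open>form x h\<close>; by
    \<open>bound\<close> the argument of \<open>nat\<close> is nonnegative on the orbit, so nothing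
    is truncated.\<close>
  define f where "f x = nat (form \<mu> \<mu> + form h h - 2 * form x h)" for x
  have "act [] \<mu> \<in> ?S" by (intro CollectI exI[of _ "[]"]) simp
  then obtain x where x: "x \<in> ?S" "\<And>y. y \<in> ?S \<Longrightarrow> f x \<le> f y"
    using ex_has_least_nat[of "\<lambda>x. x \<in> ?S" "act [] \<mu>" f] by blast
  then obtain as where as: "set as \<subseteq> \<Phi>" "x = act as \<mu>" by auto
  have "form d x \<ge> 0" if d: "d \<in> simple" for d
  proof -
    have d': "d \<in> \<Phi>" using d by (rule simple_coroot)
    have "refl d x = act (d # as) \<mu>" "set (d # as) \<subseteq> \<Phi>" using as d' by auto
    then have "refl d x \<in> ?S" by blast
    then have "form (refl d x) h \<le> form x h"
      using x(2)[of "refl d x"] bound[of "refl d x"] bound[OF x(1)] by (auto simp: f_def)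
    then have "cartan d x * form d h \<ge> 0" by (simp add: refl_def form_simps)
    then have "cartan d x \<ge> 0" using simple_height[OF d] by (simp add: zero_le_mult_iff)
    then show ?thesis using cartan_nonneg_iff[OF d'] by simp
  qed
  then show ?thesis using as by auto
qed

lemma dominant_in_orbit:
  "\<exists>m\<in>orbit \<mu>. (\<forall>d\<in>simple. form d m \<ge> 0) \<and> (\<forall>x\<in>orbit \<mu>. m - x \<in> cone)"
proof -
  obtain as where as: "set as \<subseteq> \<Phi>" and dom: "\<forall>d\<in>simple. form d (act as \<mu>) \<ge> 0"
    using ex_dominant by blast
  have "act as \<mu> - x \<in> cone" if x: "x \<in> orbit \<mu>" for x
  proof -
    obtain bs where bs: "set bs \<subseteq> \<Phi>" "x = act bs \<mu>" using x by (auto simp: orbit_def)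
    have "act (rev as) (act as \<mu>) = \<mu>" using act_rev[of "rev as"] as by simp
    then have x': "x = act (bs @ rev as) (act as \<mu>)" using bs by simp
    obtain ds where "set ds \<subseteq> simple" "\<forall>x. act (bs @ rev as) x = act ds x"
      using act_simple_word[of "bs @ rev as"] as bs by auto
    then show ?thesis using dominant_maximal[of "act as \<mu>" ds] dom x' by metis
  qed
  moreover have "act as \<mu> \<in> orbit \<mu>" using as by (auto simp: orbit_def)
  ultimately show ?thesis using dom by blast
qed

text \<open>In the proof, \<open>z = 2 \<kappa> - u\<close> is twice the difference between \<open>\<kappa>\<close> and the midpoint \<open>u / 2\<close>.\<close>

lemma descent_step:
  assumes a: "a \<in> simple" and u: "\<And>d. d \<in> simple \<Longrightarrow> form d u \<ge> 0" and au: "form a u = 0"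
    and \<nu>: "zmult 2 \<nu> = u + a"
    and nonneg: "\<And>d. d \<in> simple \<Longrightarrow> coord d (\<kappa> - \<nu>) \<ge> 0" and ne: "\<kappa> \<noteq> \<nu>"
  shows "\<exists>d\<in>simple. coord d (\<kappa> - \<nu>) > 0 \<and> form d \<kappa> > 0"
proof (rule ccontr)
  assume "\<not> ?thesis"
  then have neg: "form d \<kappa> \<le> 0" if "d \<in> simple" "coord d (\<kappa> - \<nu>) > 0" for d
    using that by force
  define v where "v = \<kappa> - \<nu>"
  define z where "z = zmult 2 v + a"
  have z: "z = zmult 2 \<kappa> - u"
    using \<nu> by (simp add: z_def v_def zmod.scale_right_diff_distrib)
  \<comment> \<open>Twice the nonpositive \<open>form d \<kappa>\<close> minus the nonnegative
    \<open>form d u\<close>.\<close>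
  have dz: "form d z \<le> 0" if "d \<in> simple" "coord d v > 0" for d
    using neg[of d] u[of d] that by (simp add: z form_simps v_def)
  have vz: "form v z \<le> 0"
    unfolding form_coord[of v z]
  proof (intro sum_nonpos)
    fix d assume d: "d \<in> simple"
    show "coord d v * form d z \<le> 0"
      using dz[OF d] nonneg[OF d] by (cases "coord d v = 0") (auto simp: v_def intro: mult_nonneg_nonpos)
  qed
  \<comment> \<open>The coordinate of \<open>z\<close> at \<open>a\<close> is odd, so
    \<open>z\<close> is nonzero even though only its coordinates were controlled.\<close>
  have "coord a z = 2 * coord a v + 1" using a by (simp add: z_def coord_simps coord_simple)
  then have "coord a z \<noteq> 0" by presburger
  then have "z \<noteq> 0" by (auto simp: coord_simps)
  then have zz: "form z z > 0" by (rule form_pos)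
  have "form z z = 2 * form v z + form a z"
    by (subst (1) z_def) (simp add: form_simps)
  then have az: "form a z > 0" using zz vz by linarith
  then have av: "coord a v = 0" using dz[OF a] nonneg[OF a] by (force simp: v_def)
  have a': "a \<in> \<Phi>" using a by (rule simple_coroot)
  have "form a z = (cartan a v + 1) * form a a"
    using cartan_form[OF a', of v] by (simp add: z_def form_simps algebra_simps)
  then have "cartan a v + 1 > 0" using az coroot_norm_pos[OF a'] by (simp add: zero_less_mult_iff)
  \<comment> \<open>Integrality improves \<open>cartan a v > -1\<close> to
    \<open>cartan a v \<ge> 0\<close>. Then \<open>form v z\<close> is at least twice
    \<open>form v v\<close>, contradicting \<open>vz\<close>.\<close>
  then have "form v a \<ge> 0" using cartan_nonneg_iff[OF a', of v] form_sym[of a v] by simp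
  moreover have "form v z = 2 * form v v + form v a" by (simp add: z_def form_simps)
  moreover have "form v v > 0" using ne by (intro form_pos) (simp add: v_def)
  ultimately show False using vz by linarith
qed

text \<open>Subtracting a \<open>d\<close> with positive coordinate leaves all coordinates of
  \<kappa> - \<nu> nonnegative, so its height stays nonnegative and strictly decreases.\<close>

lemma descent:
  assumes a: "a \<in> simple" and u: "\<And>d. d \<in> simple \<Longrightarrow> form d u \<ge> 0" and au: "form a u = 0"
    and \<nu>: "zmult 2 \<nu> = u + a"
  shows "(\<And>d. d \<in> simple \<Longrightarrow> coord d (\<kappa> - \<nu>) \<ge> 0) \<Longrightarrow> tensor_one \<kappa> \<in> orbit_hull \<mu> \<Longrightarrow>
    tensor_one \<nu> \<in> orbit_hull \<mu>"
proof (induction "nat (form (\<kappa> - \<nu>) h)" arbitrary: \<kappa> rule: less_induct)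
  case less
  show ?case
  proof (cases "\<kappa> = \<nu>")
    case False
    obtain d where d: "d \<in> simple" "coord d (\<kappa> - \<nu>) > 0" "form d \<kappa> > 0"
      using descent_step[OF a u au \<nu> less.prems(1) False] by blast
    have cd: "coord e (\<kappa> - d - \<nu>) = coord e (\<kappa> - \<nu>) - (if e = d then 1 else 0)" for e
      using d(1) by (simp add: coord_simps coord_simple)
    have nonneg: "coord e (\<kappa> - d - \<nu>) \<ge> 0" if "e \<in> simple" for e
      using cd[of e] d(2) less.prems(1)[OF that] by auto
    have "form (\<kappa> - d - \<nu>) h \<ge> 0"
      unfolding form_coord[of "\<kappa> - d - \<nu>" h] using nonneg simple_height
      by (intro sum_nonneg mult_nonneg_nonneg) (auto intro: less_imp_le)
    moreover have "form (\<kappa> - d - \<nu>) h = form (\<kappa> - \<nu>) h - form d h" by (simp add: form_simps)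
    ultimately have "nat (form (\<kappa> - d - \<nu>) h) < nat (form (\<kappa> - \<nu>) h)"
      using simple_height[OF d(1)] by linarith
    then show ?thesis
      by (rule less.hyps[OF _ nonneg])
        (use orbit_hull_string[OF simple_coroot less.prems(2)] d in auto)
  qed (use less.prems in simp)
qed

lemma half_point_simple:
  assumes a: "a \<in> simple" and u: "\<And>d. d \<in> simple \<Longrightarrow> form d u \<ge> 0" and au: "form a u = 0"
    and \<nu>: "zmult 2 \<nu> = u + a" and mid: "(1 / 2) *\<^sub>R tensor_one u \<in> orbit_hull \<mu>"
  shows "tensor_one \<nu> \<in> orbit_hull \<mu>"
proof -
  obtain m where m: "m \<in> orbit \<mu>" "\<forall>x\<in>orbit \<mu>. m - x \<in> cone"
    using dominant_in_orbit by blast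
  have "coord d (m - \<nu>) \<ge> 0" if d: "d \<in> simple" for d
  proof -
    have "coord d x \<le> coord d m" if "x \<in> orbit \<mu>" for x
      using coord_cone[of "m - x" d] m(2) that by (simp add: coord_simps)
    from orbit_hull_functional_le[OF coord_additive this mid]
    have "tensor_lift (\<lambda>x. real_of_int (coord d x)) ((1 / 2) *\<^sub>R tensor_one u) \<le> coord d m"
      by simp
    moreover have A: "Modules.additive (\<lambda>x. real_of_int (coord d x))"
      by (simp add: Modules.additive_def coord_simps)
    ultimately have "real_of_int (coord d u) \<le> 2 * coord d m"
      using linear_scale[OF tensor_lift_universal(1)[OF A]] tensor_lift_universal(2)[OF A, of u]
      by simp
    then have "coord d u \<le> 2 * coord d m" by linarith
    moreover have "2 * coord d \<nu> = coord d u + coord d a"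
      using arg_cong[OF \<nu>, of "coord d"] by (simp add: coord_simps)
    \<comment> \<open>Twice the coordinate of m - \<nu> is therefore at least -1, and being even it
      is nonnegative.\<close>
    moreover have "coord d a \<le> 1" using a by (simp add: coord_simple)
    ultimately show ?thesis by (simp add: coord_simps)
  qed
  then show ?thesis using descent[OF a u au \<nu> _ orbit_in_hull[OF m(1)]] by blast
qed

end

context coroot_system
begin

text \<open>A chamber that is adapted to \<open>u\<close> and \<open>a\<close>: positivity is decided first by \<open>u\<close>, then by a
  vector vanishing on no coroot except \<open>a\<close> and \<open>- a\<close>, and finally by \<open>a\<close>.\<close>

lemma half_point:
  assumes a: "a \<in> \<Phi>" and au: "form a u = 0"
    and \<nu>: "zmult 2 \<nu> = u + a" and mid: "(1 / 2) *\<^sub>R tensor_one u \<in> orbit_hull \<mu>"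
  shows "tensor_one \<nu> \<in> orbit_hull \<mu>"
proof -
  obtain y where y: "form a y = 0" "\<forall>b\<in>\<Phi> - {a, - a}. form b y \<noteq> 0"
    using ex_orthogonal_generic[OF a] by blast
  obtain w where w: "\<forall>b\<in>\<Phi>. (form b u > 0 \<longrightarrow> form b w > 0) \<and> (form b u < 0 \<longrightarrow> form b w < 0) \<and>
      (form b u = 0 \<longrightarrow> form b w = form b y)"
    using lex_combine[OF finite_coroots, of u y] by blast
  obtain h where h: "\<forall>b\<in>\<Phi>. (form b w > 0 \<longrightarrow> form b h > 0) \<and> (form b w < 0 \<longrightarrow> form b h < 0) \<and>
      (form b w = 0 \<longrightarrow> form b h = form b a)"
    using lex_combine[OF finite_coroots, of w a] by blast
  have aw: "form a w = 0" using w a au y by auto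
  have w0: "b = a \<or> b = - a" if "b \<in> \<Phi>" "form b w = 0" for b
    using w y that by (metis DiffI empty_iff insert_iff less_irrefl linorder_neqE)
  have ah: "form a h > 0" using h a aw coroot_norm_pos by simp
  interpret B: based_coroot_system form \<Phi> h
  proof
    fix b assume b: "b \<in> \<Phi>"
    show "form b h \<noteq> 0"
    proof (cases "form b w = 0")
      case True
      then show ?thesis using w0[OF b] ah by (auto simp: form_simps)
    next
      case False
      then show ?thesis using h b by (metis less_irrefl linorder_neqE)
    qed
  qed
  have pw: "form b w \<ge> 0" if "b \<in> B.positive" for b
    using that h by (force simp: B.positive_def)
  have w0': "b = a" if "b \<in> B.positive" "form b w = 0" for b
    using w0[of b] that ah by (auto simp: B.positive_def form_simps)
  have "a \<in> B.simple"
    unfolding B.simple_def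
  proof (intro CollectI conjI notI)
    show "a \<in> B.positive" using a ah by (simp add: B.positive_def)
    assume "\<exists>b\<in>B.positive. \<exists>c\<in>B.positive. a = b + c"
    then obtain b c where bc: "b \<in> B.positive" "c \<in> B.positive" "a = b + c" by blast
    \<comment> \<open>Positive coroots pair nonnegatively with \<open>w\<close> while their sum
      \<open>a\<close> pairs to zero, so both summands do; the only positive coroot orthogonal to
      \<open>w\<close> is \<open>a\<close>.\<close>
    then have "form b w = 0" "form c w = 0"
      using pw[of b] pw[of c] aw by (auto simp: form_simps)
    then have "b = a" "c = a" using w0'[OF bc(1)] w0'[OF bc(2)] by simp_all
    then have "a + a = a" using bc(3) by metis
    then show False using a zero_notin by simp
  qed
  \<comment> \<open>A coroot pairing negatively with \<open>u\<close> would pair negatively with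
    \<open>w\<close>, which no positive coroot does.\<close>
  moreover have "form d u \<ge> 0" if "d \<in> B.simple" for d
    using pw[OF B.simple_positive[OF that]] w B.simple_coroot[OF that] by force
  ultimately show ?thesis using au \<nu> mid by (rule B.half_point_simple)
qed

end

section \<open>The canonical form of a root datum\<close>

lemma reduced_rootsD:
  "reduced_roots R \<Longrightarrow> \<alpha> \<in> R \<Longrightarrow> \<beta> \<in> R \<Longrightarrow> m \<noteq> 0 \<Longrightarrow> zmult m \<beta> = zmult n \<alpha> \<Longrightarrow> \<beta> = \<alpha> \<or> \<beta> = - \<alpha>"
  unfolding reduced_roots_def by blast

context root_datum
begin

lemma pairing_additive: "Modules.additive (\<lambda>\<eta>. pairing \<eta> x)" "Modules.additive (pairing \<eta>)"
  by (simp_all add: Modules.additive_def pairing_add_left pairing_add_right)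

lemmas pairing_simps =
  Modules.additive.diff[OF pairing_additive(1)] Modules.additive.diff[OF pairing_additive(2)]
  Modules.additive.minus[OF pairing_additive(1)] Modules.additive.minus[OF pairing_additive(2)]
  Modules.additive.zero[OF pairing_additive(1)] Modules.additive.zero[OF pairing_additive(2)]
  additive_zmult[OF pairing_additive(1)] additive_zmult[OF pairing_additive(2)]

lemma pairing_ext_left: "(\<And>x. pairing \<eta> x = pairing \<theta> x) \<Longrightarrow> \<eta> = \<theta>"
  using perfect_left unfolding bij_betw_def inj_on_def by blast

lemma pairing_ext_right: "(\<And>\<eta>. pairing \<eta> x = pairing \<eta> y) \<Longrightarrow> x = y"
  using perfect_right unfolding bij_betw_def inj_on_def by blast

text \<open>The standard invariant form on cocharacters: integer valued, nonnegative as a sum of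
  squares, and invariant because reflections permute the roots.\<close>

definition canonical_form :: "'x \<Rightarrow> 'x \<Rightarrow> int" where
  "canonical_form x y = (\<Sum>\<delta>\<in>R. pairing \<delta> x * pairing \<delta> y)"

lemma canonical_form_additive: "Modules.additive (canonical_form x)"
  by (simp add: Modules.additive_def canonical_form_def pairing_add_right distrib_left sum.distrib)

lemma canonical_form_sym: "canonical_form x y = canonical_form y x"
  by (simp add: canonical_form_def mult.commute)

lemma canonical_form_add_left: "canonical_form (x + y) z = canonical_form x z + canonical_form y z"
  using Modules.additive.add[OF canonical_form_additive, of z] by (simp add: canonical_form_sym)

lemma coreflection_additive: "Modules.additive (coreflection pairing coroot \<alpha>)"
  by (simp add: Modules.additive_def coreflection_def pairing_add_right zmult_add_left)

text \<open>The transpose of the coreflection is the reflection \<open>s\<close> of characters, an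
  involution preserving \<open>R\<close>; it reindexes the sum.\<close>

lemma canonical_form_coreflection:
  assumes \<alpha>: "\<alpha> \<in> R"
  shows "canonical_form (coreflection pairing coroot \<alpha> x) (coreflection pairing coroot \<alpha> y) =
    canonical_form x y"
proof -
  define s where "s \<beta> = \<beta> - zmult (pairing \<beta> (coroot \<alpha>)) \<alpha>" for \<beta>
  have p: "pairing \<beta> (coreflection pairing coroot \<alpha> z) = pairing (s \<beta>) z" for \<beta> z
    by (simp add: coreflection_def s_def pairing_simps mult.commute)
  have ss: "s (s \<beta>) = \<beta>" for \<beta>
    using pairing_root_coroot[OF \<alpha>]
    by (simp add: s_def pairing_simps zmod.scale_left_diff_distrib[symmetric] algebra_simps
        flip: zmult_add_left)
  have "canonical_form (coreflection pairing coroot \<alpha> x) (coreflection pairing coroot \<alpha> y) =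
      (\<Sum>\<delta>\<in>R. pairing (s \<delta>) x * pairing (s \<delta>) y)"
    by (simp add: canonical_form_def p)
  also have "\<dots> = canonical_form x y"
    unfolding canonical_form_def
    by (rule sum.reindex_bij_witness[of _ s s]) (use ss reflect_roots[OF \<alpha>] in \<open>auto simp: s_def\<close>)
  finally show ?thesis .
qed

lemma coreflection_self: "\<alpha> \<in> R \<Longrightarrow> coreflection pairing coroot \<alpha> (coroot \<alpha>) = - coroot \<alpha>"
  using zmult_add_left[of 1 1 "coroot \<alpha>"] by (simp add: coreflection_def pairing_root_coroot)

text \<open>Invariance is applied to the coroot, which its own reflection negates. The result
  recovers \<alpha> from its coroot and the form.\<close>

lemma canonical_form_coroot:
  assumes \<alpha>: "\<alpha> \<in> R"
  shows "2 * canonical_form (coroot \<alpha>) y = pairing \<alpha> y * canonical_form (coroot \<alpha>) (coroot \<alpha>)"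
proof -
  note A = canonical_form_additive
  have "canonical_form (coroot \<alpha>) y = canonical_form (- coroot \<alpha>) (coreflection pairing coroot \<alpha> y)"
    using canonical_form_coreflection[OF \<alpha>, of "coroot \<alpha>" y] coreflection_self[OF \<alpha>] by simp
  also have "\<dots> = - canonical_form (coroot \<alpha>) (y - zmult (pairing \<alpha> y) (coroot \<alpha>))"
    by (simp add: canonical_form_sym[of "- coroot \<alpha>"] canonical_form_sym[of "coroot \<alpha>"]
        Modules.additive.minus[OF A] coreflection_def)
  finally show ?thesis
    by (simp add: Modules.additive.diff[OF A] additive_zmult[OF A])
qed

text \<open>If the sum of squares vanishes, all roots kill \<open>x\<close>; so does every
  character, having a positive multiple in the root lattice, and the pairing is perfect.\<close>

lemma canonical_form_pos:
  assumes "semisimple_roots R" "x \<noteq> 0"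
  shows "canonical_form x x > 0"
proof (rule ccontr)
  assume "\<not> ?thesis"
  moreover have "canonical_form x x \<ge> 0" by (simp add: canonical_form_def sum_nonneg)
  ultimately have "(\<Sum>\<delta>\<in>R. pairing \<delta> x * pairing \<delta> x) = 0" by (simp add: canonical_form_def)
  then have R: "pairing \<delta> x = 0" if "\<delta> \<in> R" for \<delta>
    using that finite_roots by (simp add: sum_nonneg_eq_0_iff)
  have span: "pairing \<theta> x = 0" if "\<theta> \<in> zmod.span R" for \<theta>
    using that
    by (induction rule: zmod.span_induct_alt) (auto simp: pairing_simps pairing_add_left R)
  have "pairing \<eta> x = pairing \<eta> 0" for \<eta>
  proof -
    obtain n where "n > 0" "zmult n \<eta> \<in> zmod.span R"
      using assms(1) by (auto simp: semisimple_roots_def)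
    then show ?thesis using span[of "zmult n \<eta>"] by (simp add: pairing_simps)
  qed
  then show False using pairing_ext_right assms(2) by blast
qed

lemma coroot_nonzero: "\<alpha> \<in> R \<Longrightarrow> coroot \<alpha> \<noteq> 0"
  using pairing_root_coroot[of \<alpha>] by (auto simp: pairing_simps)

context
  assumes semisimple: "semisimple_roots R"
begin

lemma canonical_form_coroot_pos: "\<alpha> \<in> R \<Longrightarrow> canonical_form (coroot \<alpha>) (coroot \<alpha>) > 0"
  using canonical_form_pos[OF semisimple] coroot_nonzero by blast

text \<open>The sum of the two coroots has norm zero: each pairs to -2 with the root of the other,
  so the mixed terms cancel the squares.\<close>

lemma coroot_minus:
  assumes "\<alpha> \<in> R" "- \<alpha> \<in> R"
  shows "coroot (- \<alpha>) = - coroot \<alpha>"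
proof (rule ccontr)
  assume "\<not> ?thesis"
  then have "coroot (- \<alpha>) + coroot \<alpha> \<noteq> 0" by (simp add: eq_neg_iff_add_eq_0)
  from canonical_form_pos[OF semisimple this]
  have "canonical_form (coroot (- \<alpha>)) (coroot (- \<alpha>)) + canonical_form (coroot (- \<alpha>)) (coroot \<alpha>) +
      (canonical_form (coroot \<alpha>) (coroot (- \<alpha>)) + canonical_form (coroot \<alpha>) (coroot \<alpha>)) > 0"
    by (simp add: Modules.additive.add[OF canonical_form_additive] canonical_form_add_left add_ac)
  moreover have "2 * canonical_form (coroot (- \<alpha>)) (coroot \<alpha>) =
      - 2 * canonical_form (coroot (- \<alpha>)) (coroot (- \<alpha>))"
    using canonical_form_coroot[OF assms(2), of "coroot \<alpha>"] pairing_root_coroot[OF assms(1)]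
    by (simp add: pairing_simps)
  moreover have "pairing \<alpha> (coroot (- \<alpha>)) = - 2"
    using pairing_root_coroot[OF assms(2)] by (simp add: pairing_simps)
  then have "2 * canonical_form (coroot \<alpha>) (coroot (- \<alpha>)) =
      - 2 * canonical_form (coroot \<alpha>) (coroot \<alpha>)"
    using canonical_form_coroot[OF assms(1), of "coroot (- \<alpha>)"] by simp
  ultimately show False by linarith
qed

lemma pairing_eq_div:
  "\<alpha> \<in> R \<Longrightarrow> 2 * canonical_form (coroot \<alpha>) x div canonical_form (coroot \<alpha>) (coroot \<alpha>) = pairing \<alpha> x"
  using canonical_form_coroot[of \<alpha> x] canonical_form_coroot_pos[of \<alpha>] by simp

text \<open>Through the form each root is a positive multiple of its coroot, so a proportionality of
  coroots becomes one of roots.\<close>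

lemma coroots_reduced:
  assumes red: "reduced_roots R" and \<alpha>: "\<alpha> \<in> R" and \<beta>: "\<beta> \<in> R" and m: "m \<noteq> 0"
    and eq: "zmult m (coroot \<beta>) = zmult k (coroot \<alpha>)"
  shows "coroot \<beta> = coroot \<alpha> \<or> coroot \<beta> = - coroot \<alpha>"
proof -
  define A where "A = canonical_form (coroot \<alpha>) (coroot \<alpha>)"
  define B where "B = canonical_form (coroot \<beta>) (coroot \<beta>)"
  have B: "B > 0" using canonical_form_coroot_pos[OF \<beta>] by (simp add: B_def)
  have "zmult (m * B) \<beta> = zmult (k * A) \<alpha>"
  proof (rule pairing_ext_left)
    fix x
    have "canonical_form x (zmult m (coroot \<beta>)) = canonical_form x (zmult k (coroot \<alpha>))"
      by (simp only: eq)
    then have "m * canonical_form (coroot \<beta>) x = k * canonical_form (coroot \<alpha>) x"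
      by (simp add: additive_zmult[OF canonical_form_additive] canonical_form_sym[of x])
    then have "m * (pairing \<beta> x * B) = k * (pairing \<alpha> x * A)"
      using canonical_form_coroot[OF \<beta>, of x] canonical_form_coroot[OF \<alpha>, of x]
      unfolding A_def B_def by (metis mult.left_commute)
    then show "pairing (zmult (m * B) \<beta>) x = pairing (zmult (k * A) \<alpha>) x"
      by (simp add: pairing_simps mult_ac)
  qed
  then have "\<beta> = \<alpha> \<or> \<beta> = - \<alpha>" using m B by (intro reduced_rootsD[OF red \<alpha> \<beta>]) auto
  then show ?thesis using coroot_minus[OF \<alpha>] \<beta> by auto
qed

lemma coroot_system:
  assumes "reduced_roots R" "simply_connected_datum R coroot"
  shows "coroot_system canonical_form (coroot ` R)"
proof
  show "canonical_form (x + y) z = canonical_form x z + canonical_form y z" for x y z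
    by (rule canonical_form_add_left)
  show "canonical_form x y = canonical_form y x" for x y by (rule canonical_form_sym)
  show "x \<noteq> 0 \<Longrightarrow> canonical_form x x > 0" for x by (rule canonical_form_pos[OF semisimple])
  show "finite (coroot ` R)" using finite_roots by simp
  show "0 \<notin> coroot ` R" using coroot_nonzero by force
  show "canonical_form a a dvd 2 * canonical_form a x" if "a \<in> coroot ` R" for a x
    using that canonical_form_coroot by auto
  show "b - zmult (2 * canonical_form a b div canonical_form a a) a \<in> coroot ` R"
    if "a \<in> coroot ` R" "b \<in> coroot ` R" for a b
    using that pairing_eq_div reflect_coroots by auto
  show "zmod.span (coroot ` R) = UNIV"
    using assms(2) by (simp add: simply_connected_datum_def coroot_lattice_def)
  show "b = a \<or> b = - a" if "a \<in> coroot ` R" "b \<in> coroot ` R" "m \<noteq> 0" "zmult m b = zmult k a"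
    for a b m k
    using that coroots_reduced[OF assms(1)] by auto
qed

end

section \<open>From the root datum to the coroot system\<close>

lemma coreflection_eq_refl:
  assumes ss: "semisimple_roots R" and S: "coroot_system canonical_form (coroot ` R)"
    and \<alpha>: "\<alpha> \<in> R"
  shows "coreflection pairing coroot \<alpha> = coroot_system.refl canonical_form (coroot \<alpha>)"
  by (rule ext) (simp add: coreflection_def coroot_system.refl_def[OF S]
      coroot_system.cartan_def[OF S] pairing_eq_div[OF ss \<alpha>])

text \<open>The rule \<open>reflection\<close> composes on the left exactly as a word grows at its
  head, so both descriptions yield the same orbit.\<close>

lemma conv_orbit_eq:
  assumes ss: "semisimple_roots R" and S: "coroot_system canonical_form (coroot ` R)"
  shows "conv_orbit pairing R coroot \<mu> = coroot_system.orbit_hull canonical_form (coroot ` R) \<mu>"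
proof -
  interpret S: coroot_system canonical_form "coroot ` R" by (rule S)
  note refl = coreflection_eq_refl[OF ss S]
  have 1: "\<exists>as. set as \<subseteq> coroot ` R \<and> w x = S.act as x" if "w \<in> weyl_group pairing R coroot" for w x
    using that
  proof induction
    case id
    show ?case by (intro exI[of _ "[]"]) simp
  next
    case (reflection \<alpha> w)
    then obtain as where "set as \<subseteq> coroot ` R" "w x = S.act as x" by blast
    then show ?case using reflection refl by (intro exI[of _ "coroot \<alpha> # as"]) simp
  qed
  have 2: "S.act as \<in> weyl_group pairing R coroot" if "set as \<subseteq> coroot ` R" for as
    using that
  proof (induction as)
    case Nil
    show ?case using weyl_group.id by (simp add: id_def)
  next
    case (Cons a as)
    then obtain \<alpha> where \<alpha>: "\<alpha> \<in> R" "a = coroot \<alpha>" by auto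
    have "coreflection pairing coroot \<alpha> \<circ> S.act as \<in> weyl_group pairing R coroot"
      using Cons \<alpha> by (intro weyl_group.reflection) auto
    then show ?case using refl[OF \<alpha>(1)] \<alpha>(2) by (simp add: o_def)
  qed
  have "{w \<mu> |w. w \<in> weyl_group pairing R coroot} = S.orbit \<mu>"
    unfolding S.orbit_def using 1 2 by blast
  moreover have "{tensor_one (w \<mu>) | w. w \<in> weyl_group pairing R coroot} =
      tensor_one ` {w \<mu> |w. w \<in> weyl_group pairing R coroot}"
    by blast
  ultimately have "{tensor_one (w \<mu>) | w. w \<in> weyl_group pairing R coroot} =
      tensor_one ` S.orbit \<mu>" by simp
  then show ?thesis by (simp add: conv_orbit_def S.orbit_hull_def)
qed

text \<open>The nontrivial inclusion. The lattice points over \<open>\<phi> x\<close> form the coset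
  of \<open>x\<close> modulo the coroot, and one nearest to the midpoint of the segment above
  \<open>\<phi> x\<close> is chosen.\<close>

lemma ex_integral_point:
  assumes red: "reduced_roots R" and ss: "semisimple_roots R" and sc: "simply_connected_datum R coroot"
    and \<alpha>: "\<alpha> \<in> R" "- \<alpha> \<in> R"
    and \<phi>: "quotient_projection \<phi> (coroot_lattice coroot {\<alpha>, - \<alpha>})"
    and c: "c \<in> conv_orbit pairing R coroot \<mu>" and eq: "tensor_one (\<phi> x) = tensor_map \<phi> c"
  shows "\<exists>\<nu>. \<phi> \<nu> = \<phi> x \<and> tensor_one \<nu> \<in> conv_orbit pairing R coroot \<mu>"
proof -
  note S = coroot_system[OF ss red sc]
  interpret S: coroot_system canonical_form "coroot ` R" by (rule S)
  define s where "s = coreflection pairing coroot \<alpha>"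
  let ?a = "coroot \<alpha>" and ?C = "S.orbit_hull \<mu>"
  have a: "?a \<in> coroot ` R" using \<alpha> by simp
  have C: "conv_orbit pairing R coroot \<mu> = ?C" by (rule conv_orbit_eq[OF ss S])
  have s_refl: "s = S.refl ?a" unfolding s_def by (rule coreflection_eq_refl[OF ss S \<alpha>(1)])
  have s_add: "Modules.additive s" unfolding s_def by (rule coreflection_additive)
  define u where "u = x + s x"
  have \<phi>_add: "Modules.additive \<phi>" using \<phi> by (simp add: quotient_projection_def)
  have "?a \<in> coroot_lattice coroot {\<alpha>, - \<alpha>}"
    by (simp add: coroot_lattice_def zmod.span_base)
  then have \<phi>a: "\<phi> ?a = 0" using \<phi> by (auto simp: quotient_projection_def)
  have mid: "(1 / 2) *\<^sub>R tensor_one u \<in> ?C"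
  proof -
    \<comment> \<open>Symmetrization under \<open>s\<close> kills the coroot, which \<open>s\<close>
      negates, so it depends only on the image under \<phi>. Hence it takes the same value at
      \<open>c\<close> and at \<open>x\<close>.\<close>
    define f where "f y = tensor_one y + tensor_one (s y)" for y
    have f: "Modules.additive f"
      using s_add by (simp add: Modules.additive_def f_def tensor_one_add)
    have fa: "f ?a = 0"
      by (simp add: f_def s_def coreflection_self[OF \<alpha>(1)]
          Modules.additive.minus[OF tensor_one_additive])
    have f0: "f y = 0" if "y \<in> coroot_lattice coroot {\<alpha>, - \<alpha>}" for y
      using that unfolding coroot_lattice_def
      by (induction rule: zmod.span_induct_alt)
        (auto simp: Modules.additive.zero[OF f] Modules.additive.add[OF f] additive_zmult[OF f] fa
          coroot_minus[OF ss \<alpha>] Modules.additive.minus[OF f])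
    have "tensor_map \<phi> c = tensor_map \<phi> (tensor_one x)"
      using eq tensor_map_linear(2)[OF \<phi>_add] by simp
    from tensor_lift_eq_of_tensor_map_eq[OF \<phi> f f0 this]
    have "tensor_lift f c = f x" by (simp only: tensor_lift_universal(2)[OF f])
    then have "tensor_lift f c = tensor_one u" by (simp add: f_def u_def tensor_one_add)
    moreover have "(\<lambda>c. c + tensor_map s c) = tensor_lift f"
      by (rule tensor_lift_universal(3)[OF f])
        (simp_all add: linear_compose_add linear_ident tensor_map_linear[OF s_add] f_def)
    \<comment> \<open>Thus half of \<open>u\<close> is the midpoint of \<open>c\<close> and its
      reflection, both of which lie in the hull.\<close>
    ultimately have "c + tensor_map s c = tensor_one u" by metis
    moreover have "(1 / 2) *\<^sub>R c + (1 / 2) *\<^sub>R tensor_map s c \<in> ?C"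
      using c C S.refl_orbit_hull[OF a, of c \<mu>] by (intro convexD[OF S.convex_orbit_hull]) (auto simp: s_refl)
    ultimately show ?thesis by (metis scaleR_add_right)
  qed
  define k where "k = pairing \<alpha> x"
  \<comment> \<open>As \<open>u\<close> is 2 x minus k times the coroot, rounding k / 2 down makes
    twice \<nu> equal to \<open>u\<close> for even k, and to \<open>u\<close> plus the coroot for
    odd k.\<close>
  define \<nu> where "\<nu> = x - zmult (k div 2) ?a"
  have u: "u = zmult 2 x - zmult k ?a"
    using zmult_add_left[of 1 1 x] by (simp add: u_def s_def coreflection_def k_def)
  have "\<phi> \<nu> = \<phi> x"
    by (simp add: \<nu>_def Modules.additive.diff[OF \<phi>_add] additive_zmult[OF \<phi>_add] \<phi>a)
  moreover have "tensor_one \<nu> \<in> ?C"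
  proof (cases "even k")
    case True
    then have "u = zmult 2 \<nu>"
      by (simp add: u \<nu>_def zmod.scale_right_diff_distrib)
    then show ?thesis using mid by (simp add: tensor_one_zmult)
  next
    case False
    then have k: "k = 2 * (k div 2) + 1" by presburger
    have "zmult k ?a = zmult 2 (zmult (k div 2) ?a) + ?a"
      by (subst k) (simp add: zmult_Suc)
    then have "zmult 2 \<nu> = u + ?a"
      by (simp add: u \<nu>_def zmod.scale_right_diff_distrib)
    moreover have "canonical_form ?a u = 0"
    proof -
      have "pairing \<alpha> u = 0"
        by (simp add: u pairing_simps pairing_root_coroot[OF \<alpha>(1)] k_def)
      then show ?thesis using canonical_form_coroot[OF \<alpha>(1), of u] by simp
    qed
    ultimately show ?thesis using S.half_point[OF a _ _ mid] by blast
  qed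
  ultimately show ?thesis using C by blast
qed

end

theorem theorem2p3:
  fixes pairing :: "'c::ab_group_add \<Rightarrow> 'x::ab_group_add \<Rightarrow> int"
    and R R\<^sub>B R\<^sub>P :: "'c set"
    and coroot :: "'c \<Rightarrow> 'x"
    and \<phi>\<^sub>G :: "'x \<Rightarrow> 'xg::ab_group_add"
    and \<phi>\<^sub>M :: "'x \<Rightarrow> 'xm::ab_group_add"
    and \<mu> :: 'x
  assumes "root_datum pairing R coroot" and "reduced_roots R"
    and "semisimple_roots R" and "simply_connected_datum R coroot"
    and "borel_roots R R\<^sub>B"
    and "parabolic_roots R R\<^sub>P" and "R\<^sub>B \<subseteq> R\<^sub>P" and "semisimple_rank_one R R\<^sub>P"
    and "quotient_projection \<phi>\<^sub>G (coroot_lattice coroot R)"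
    and "quotient_projection \<phi>\<^sub>M (coroot_lattice coroot (levi_roots R\<^sub>P))"
    and "dominant pairing R\<^sub>B \<mu>"
  shows "\<phi>\<^sub>M ` P_set pairing R coroot \<phi>\<^sub>G \<mu> =
    {\<nu>\<^sub>1. induced_map \<phi>\<^sub>M \<phi>\<^sub>G \<nu>\<^sub>1 = \<phi>\<^sub>G \<mu> \<and>
         tensor_one \<nu>\<^sub>1 \<in> tensor_map \<phi>\<^sub>M ` conv_orbit pairing R coroot \<mu>}"
proof -
  interpret root_datum pairing R coroot by fact
  obtain \<alpha> where \<alpha>: "\<alpha> \<in> R" and levi: "levi_roots R\<^sub>P = {\<alpha>, - \<alpha>}"
    using assms(8) by (auto simp: semisimple_rank_one_def)
  have sub: "levi_roots R\<^sub>P \<subseteq> R"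
    using assms(6) by (auto simp: levi_roots_def parabolic_roots_def)
  then have \<alpha>': "- \<alpha> \<in> R" using levi by auto
  have add: "Modules.additive \<phi>\<^sub>M" and surj: "surj \<phi>\<^sub>M"
    using assms(10) by (auto simp: quotient_projection_def)
  have "coroot_lattice coroot (levi_roots R\<^sub>P) \<subseteq> coroot_lattice coroot R"
    unfolding coroot_lattice_def using sub by (intro zmod.span_mono image_mono)
  then have ind: "induced_map \<phi>\<^sub>M \<phi>\<^sub>G (\<phi>\<^sub>M x) = \<phi>\<^sub>G x" for x
    by (rule induced_map_apply[OF assms(10,9)])
  \<comment> \<open>The coroot lattice is the whole of X, so \<open>\<phi>\<^sub>G\<close> vanishes
    and the conditions on images in its target hold on both sides.\<close>
  have G: "\<phi>\<^sub>G x = 0" for x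
    using assms(4,9) by (auto simp: simply_connected_datum_def quotient_projection_def)
  show ?thesis
  proof (intro equalityI subsetI)
    fix \<nu>\<^sub>1 assume "\<nu>\<^sub>1 \<in> \<phi>\<^sub>M ` P_set pairing R coroot \<phi>\<^sub>G \<mu>"
    then obtain \<nu> where "\<nu>\<^sub>1 = \<phi>\<^sub>M \<nu>" "tensor_one \<nu> \<in> conv_orbit pairing R coroot \<mu>"
      by (auto simp: P_set_def)
    then show "\<nu>\<^sub>1 \<in> {\<nu>\<^sub>1. induced_map \<phi>\<^sub>M \<phi>\<^sub>G \<nu>\<^sub>1 = \<phi>\<^sub>G \<mu> \<and>
         tensor_one \<nu>\<^sub>1 \<in> tensor_map \<phi>\<^sub>M ` conv_orbit pairing R coroot \<mu>}"
      using tensor_map_linear(2)[OF add, of \<nu>] by (auto simp: ind G intro!: image_eqI[of _ _ "tensor_one \<nu>"])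
  next
    fix \<nu>\<^sub>1 assume "\<nu>\<^sub>1 \<in> {\<nu>\<^sub>1. induced_map \<phi>\<^sub>M \<phi>\<^sub>G \<nu>\<^sub>1 = \<phi>\<^sub>G \<mu> \<and>
         tensor_one \<nu>\<^sub>1 \<in> tensor_map \<phi>\<^sub>M ` conv_orbit pairing R coroot \<mu>}"
    then obtain c x where c: "c \<in> conv_orbit pairing R coroot \<mu>"
      and x: "\<nu>\<^sub>1 = \<phi>\<^sub>M x" "tensor_one (\<phi>\<^sub>M x) = tensor_map \<phi>\<^sub>M c"
      using surj by (auto simp: surj_def) metis
    from assms(10) have "quotient_projection \<phi>\<^sub>M (coroot_lattice coroot {\<alpha>, - \<alpha>})"
      by (simp add: levi)
    from ex_integral_point[OF assms(2-4) \<alpha> \<alpha>' this c x(2)]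
    obtain \<nu> where \<nu>: "\<phi>\<^sub>M \<nu> = \<phi>\<^sub>M x" "tensor_one \<nu> \<in> conv_orbit pairing R coroot \<mu>" by blast
    then have "\<nu> \<in> P_set pairing R coroot \<phi>\<^sub>G \<mu>" by (simp add: P_set_def G)
    then show "\<nu>\<^sub>1 \<in> \<phi>\<^sub>M ` P_set pairing R coroot \<phi>\<^sub>G \<mu>" using \<nu>(1) x(1) by (metis image_eqI)
  qed
qed

end
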